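(* Consider pairs $(\mathbb A,B)$ with the Poisson brackets of type (ii): $$\{\overset{1}{\mathbb A},\overset{2}{\mathbb A}\}=r_{12}\overset{1}{\mathbb A}\overset{2}{\mathbb A}-\overset{1}{\mathbb A}\overset{2}{\mathbb A}r_{12}+\overset{1}{\mathbb A}r_{12}^{t_1}\overset{2}{\mathbb A}-\overset{2}{\mathbb A}r_{12}^{t_1}\overset{1}{\mathbb A},\quad \{\overset{1}{B},\overset{2}{B}\}=r_{12}\overset{1}{B}\overset{2}{B}-\overset{1}{B}\overset{2}{B}r_{12},\quad \{\overset{1}{B},\overset{2}{\mathbb A}\}=-\overset{1}{B}r_{12}^{t_2}\overset{2}{\mathbb A}-\overset{1}{B}\overset{2}{\mathbb A}r_{12}.$$ The following are $2\left[\frac N2\right]$ algebraically independent Casimir functions of these brackets: $\bullet$ the $\left[\frac N2\right]$ coefficients $Y_p$ of the $\lambda$-expansion $$\frac{\det(\lambda\mathbb A+\lambda^{-1}\mathbb A^{\mathrm T})}{\det\mathbb A}=(\lambda^N+\lambda^{-N})+\sum_{p=1}^{[N/2]}(\lambda^{N-2p}+\lambda^{2p-N})Y_p;$$ $\bullet$ the $\left[\frac N2\right]$ functions $$X_p:=\frac{M_S^pM_S^{N-p}}{M_B^{N-p}M_B^p}\cdot\frac{[\det B]^2}{\det\mathbb A},\qquad p=1,\dots,[N/2],$$ where $M_S^q$ are the $(q\times q)$ principal minors (situated at the upper-left corner) of the matrix $S=\mathbb A^{\mathrm T}B^{-1}$ and $M_B^q$ are the $(q\times q)$-minors of $B$ situated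 at the upper-right corner.
   Context: $\mathbb A$ is an $N\times N$ complex matrix (generic, in particular $\det\mathbb A\neq0$), $B\in GL_N(\mathbb C)$. $E_{i,j}$ are the $N\times N$ matrix units. For an $N\times N$ matrix $X$ write $\overset{1}{X}=X\otimes I$, $\overset{2}{X}=I\otimes X$. For $T\in \mathrm{Mat}_N\otimes\mathrm{Mat}_N$, $T^{t_1}$ and $T^{t_2}$ denote transposition in the first, respectively second, tensor factor. $\{\overset{1}{X},\overset{2}{Y}\}=\sum_{i,j,k,l}\{x_{i,j},y_{k,l}\}E_{i,j}\otimes E_{k,l}$. The classical $r$-matrix is $r_{12}=\sum_i E_{i,i}\otimes E_{i,i}+2\sum_{i>j}E_{i,j}\otimes E_{j,i}$. $[x]$ is the integer part of $x$. Casimir functions are (rational) functions that Poisson commute with all entries of $\mathbb A$ and $B$. The upper-right $(q\times q)$-minor uses rows $1,\dots,q$ and columns $N-q+1,\dots,N$. *)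

theory Defs
  imports
    "HOL-Analysis.Derivative"
    "HOL-Library.Poly_Mapping"
    "Jordan_Normal_Form.Determinant"
    "Jordan_Normal_Form.Gauss_Jordan_Elimination"
    "Jordan_Normal_Form.DL_Submatrix"
begin

text \<open>Matrix indices run over \<open>0..<N\<close>, so all row and column numbers are shifted by one
  against the usual ones.\<close>

type_synonym point = "complex mat \<times> complex mat"

subsection \<open>Tensor products of matrices\<close>

definition mat_unit :: "nat \<Rightarrow> nat \<Rightarrow> nat \<Rightarrow> complex mat" where
  "mat_unit N i j = mat N N (\<lambda>(k, l). if k = i \<and> l = j then 1 else 0)"

text \<open>\<open>Mat\<^sub>N \<otimes> Mat\<^sub>N\<close> is identified with the \<open>N\<^sup>2 \<times> N\<^sup>2\<close> matrices by the Kronecker product: the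
  coefficient of \<open>E\<^sub>i\<^sub>j \<otimes> E\<^sub>k\<^sub>l\<close> is the entry in row \<open>i * N + k\<close> and column \<open>j * N + l\<close>.\<close>

definition tensor :: "nat \<Rightarrow> complex mat \<Rightarrow> complex mat \<Rightarrow> complex mat" where
  "tensor N X Y = mat (N * N) (N * N)
     (\<lambda>(a, b). X $$ (a div N, b div N) * Y $$ (a mod N, b mod N))"

definition tcoeff :: "nat \<Rightarrow> complex mat \<Rightarrow> nat \<Rightarrow> nat \<Rightarrow> nat \<Rightarrow> nat \<Rightarrow> complex" where
  "tcoeff N T i j k l = T $$ (i * N + k, j * N + l)"

definition in_first :: "nat \<Rightarrow> complex mat \<Rightarrow> complex mat" where
  "in_first N X = tensor N X (1\<^sub>m N)"

definition in_second :: "nat \<Rightarrow> complex mat \<Rightarrow> complex mat" where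
  "in_second N X = tensor N (1\<^sub>m N) X"

definition transpose1 :: "nat \<Rightarrow> complex mat \<Rightarrow> complex mat" where
  "transpose1 N T = mat (N * N) (N * N)
     (\<lambda>(a, b). tcoeff N T (b div N) (a div N) (a mod N) (b mod N))"

definition transpose2 :: "nat \<Rightarrow> complex mat \<Rightarrow> complex mat" where
  "transpose2 N T = mat (N * N) (N * N)
     (\<lambda>(a, b). tcoeff N T (a div N) (b div N) (b mod N) (a mod N))"

definition r_matrix :: "nat \<Rightarrow> complex mat" where
  "r_matrix N = mat (N * N) (N * N) (\<lambda>ab.
     (\<Sum>i<N. tensor N (mat_unit N i i) (mat_unit N i i) $$ ab) +
     2 * (\<Sum>i<N. \<Sum>j<i. tensor N (mat_unit N i j) (mat_unit N j i) $$ ab))"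

subsection \<open>The brackets\<close>

definition bracket_AA :: "nat \<Rightarrow> complex mat \<Rightarrow> complex mat" where
  "bracket_AA N A =
     (let r = r_matrix N; A1 = in_first N A; A2 = in_second N A
      in r * A1 * A2 - A1 * A2 * r + A1 * transpose1 N r * A2 - A2 * transpose1 N r * A1)"

definition bracket_BB :: "nat \<Rightarrow> complex mat \<Rightarrow> complex mat" where
  "bracket_BB N B =
     (let r = r_matrix N; B1 = in_first N B; B2 = in_second N B
      in r * B1 * B2 - B1 * B2 * r)"

definition bracket_BA :: "nat \<Rightarrow> complex mat \<Rightarrow> complex mat \<Rightarrow> complex mat" where
  "bracket_BA N B A =
     (let r = r_matrix N; B1 = in_first N B; A2 = in_second N A
      in - (B1 * transpose2 N r * A2) - B1 * A2 * r)"

datatype coord = EntA nat nat | EntB nat nat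

definition coords :: "nat \<Rightarrow> coord set" where
  "coords N = {EntA i j | i j. i < N \<and> j < N} \<union> {EntB i j | i j. i < N \<and> j < N}"

fun entry :: "coord \<Rightarrow> point \<Rightarrow> complex" where
  "entry (EntA i j) (A, B) = A $$ (i, j)"
| "entry (EntB i j) (A, B) = B $$ (i, j)"

text \<open>The value at the point \<open>(A, B)\<close> of the bracket of two coordinate functions; the brackets
  of the entries of \<open>A\<close> with those of \<open>B\<close> follow from \<open>bracket_BA\<close> by antisymmetry.\<close>

fun coord_bracket :: "nat \<Rightarrow> coord \<Rightarrow> coord \<Rightarrow> point \<Rightarrow> complex" where
  "coord_bracket N (EntA i j) (EntA k l) (A, B) = tcoeff N (bracket_AA N A) i j k l"
| "coord_bracket N (EntB i j) (EntB k l) (A, B) = tcoeff N (bracket_BB N B) i j k l"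
| "coord_bracket N (EntB i j) (EntA k l) (A, B) = tcoeff N (bracket_BA N B A) i j k l"
| "coord_bracket N (EntA i j) (EntB k l) (A, B) = - tcoeff N (bracket_BA N B A) k l i j"

fun pderiv_at :: "nat \<Rightarrow> coord \<Rightarrow> (point \<Rightarrow> complex) \<Rightarrow> point \<Rightarrow> complex" where
  "pderiv_at N (EntA i j) f (A, B) = deriv (\<lambda>t. f (A + t \<cdot>\<^sub>m mat_unit N i j, B)) 0"
| "pderiv_at N (EntB i j) f (A, B) = deriv (\<lambda>t. f (A, B + t \<cdot>\<^sub>m mat_unit N i j)) 0"

text \<open>The extension of the bracket to functions by the Leibniz rule.\<close>

definition bracket :: "nat \<Rightarrow> (point \<Rightarrow> complex) \<Rightarrow> (point \<Rightarrow> complex) \<Rightarrow> point \<Rightarrow> complex" where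
  "bracket N f g x =
     (\<Sum>u\<in>coords N. \<Sum>v\<in>coords N.
        pderiv_at N u f x * pderiv_at N v g x * coord_bracket N u v x)"

subsection \<open>Rational functions, Casimir functions, algebraic independence\<close>

text \<open>Polynomials over the complex numbers in variables of type \<open>'v\<close>.\<close>

type_synonym 'v cpoly = "('v \<Rightarrow>\<^sub>0 nat) \<Rightarrow>\<^sub>0 complex"

definition cpoly_vars :: "'v cpoly \<Rightarrow> 'v set" where
  "cpoly_vars P = (\<Union>m\<in>Poly_Mapping.keys P. Poly_Mapping.keys m)"

definition cpoly_eval :: "'v cpoly \<Rightarrow> ('v \<Rightarrow> complex) \<Rightarrow> complex" where
  "cpoly_eval P x = (\<Sum>m\<in>Poly_Mapping.keys P.
     Poly_Mapping.lookup P m * (\<Prod>v\<in>Poly_Mapping.keys m. x v ^ Poly_Mapping.lookup m v))"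

definition rational_on :: "nat \<Rightarrow> point set \<Rightarrow> (point \<Rightarrow> complex) \<Rightarrow> bool" where
  "rational_on N D F \<longleftrightarrow>
     (\<exists>P Q. cpoly_vars P \<subseteq> coords N \<and> cpoly_vars Q \<subseteq> coords N \<and>
        (\<forall>x\<in>D. cpoly_eval Q (\<lambda>u. entry u x) \<noteq> 0 \<and>
           F x = cpoly_eval P (\<lambda>u. entry u x) / cpoly_eval Q (\<lambda>u. entry u x)))"

text \<open>\<open>D\<close> is meant to be a nonempty Zariski open set of pairs of \<open>N \<times> N\<close> matrices on which \<open>F\<close>
  is regular. The bracket then vanishes on \<open>D\<close> if and only if it vanishes as a rational function,
  and the values of \<open>F\<close> outside \<open>D\<close> do not matter.\<close>

definition casimir_on :: "nat \<Rightarrow> point set \<Rightarrow> (point \<Rightarrow> complex) \<Rightarrow> bool" where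
  "casimir_on N D F \<longleftrightarrow>
     rational_on N D F \<and> (\<forall>x\<in>D. \<forall>u\<in>coords N. bracket N F (entry u) x = 0)"

definition alg_independent_on ::
    "point set \<Rightarrow> 'v set \<Rightarrow> ('v \<Rightarrow> point \<Rightarrow> complex) \<Rightarrow> bool" where
  "alg_independent_on D I F \<longleftrightarrow>
     (\<forall>P :: 'v cpoly. cpoly_vars P \<subseteq> I \<and> P \<noteq> 0 \<longrightarrow> (\<exists>x\<in>D. cpoly_eval P (\<lambda>v. F v x) \<noteq> 0))"

subsection \<open>The minors\<close>

definition S_mat :: "complex mat \<Rightarrow> complex mat \<Rightarrow> complex mat" where
  "S_mat A B = transpose_mat A * the (mat_inverse B)"

definition minor_S :: "nat \<Rightarrow> complex mat \<Rightarrow> complex mat \<Rightarrow> complex" where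
  "minor_S q A B = det (submatrix (S_mat A B) {0..<q} {0..<q})"

definition minor_B :: "nat \<Rightarrow> nat \<Rightarrow> complex mat \<Rightarrow> complex" where
  "minor_B N q B = det (submatrix B {0..<q} {N - q..<N})"

definition X_fun :: "nat \<Rightarrow> nat \<Rightarrow> point \<Rightarrow> complex" where
  "X_fun N p = (\<lambda>(A, B).
     (minor_S p A B * minor_S (N - p) A B) / (minor_B N (N - p) B * minor_B N p B) *
     ((det B)\<^sup>2 / det A))"

definition nondegenerate :: "nat \<Rightarrow> point set" where
  "nondegenerate N =
     {(A, B). A \<in> carrier_mat N N \<and> B \<in> carrier_mat N N \<and> det A \<noteq> 0 \<and> det B \<noteq> 0}"

definition X_domain :: "nat \<Rightarrow> nat \<Rightarrow> point set" where
  "X_domain N p =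
     {(A, B) \<in> nondegenerate N. minor_B N (N - p) B \<noteq> 0 \<and> minor_B N p B \<noteq> 0}"

definition generic :: "nat \<Rightarrow> point set" where
  "generic N = nondegenerate N \<inter> (\<Inter>p\<in>{1..N div 2}. X_domain N p)"

end

theory Submission
  imports Defs "HOL-Computational_Algebra.Fundamental_Theorem_Algebra"
begin

text \<open>With \<open>theta i j\<close> denoting the coefficient of \<open>E\<^sub>i\<^sub>j \<otimes> E\<^sub>j\<^sub>i\<close> in the \<open>r\<close>-matrix, the brackets
  of the entries are explicit quadratic polynomials. Contracting them with the cofactors of
  \<open>z A + v A\<^sup>T\<close>, of a corner minor of \<open>B\<close> or of a leading minor of \<open>S\<close> collapses every sum, because
  \<open>theta\<close> vanishes on those of these rows and columns that lie outside the minor. Hence the bracket of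
  such a determinant with an entry of \<open>A\<close> or \<open>B\<close> is an integer multiple (the weight) of their product,
  and the weights of the factors of \<open>X\<^sub>p\<close> and of the quotients \<open>det (z A + v A\<^sup>T) / det A\<close> add up to \<open>0\<close>.

  For the independence, take \<open>A\<close> and \<open>B\<close> antidiagonal. Then \<open>det (w A + A\<^sup>T) / det A\<close> is a product of
  factors \<open>w\<^sup>2 + u\<^sub>i w + 1\<close> (and \<open>w + 1\<close> for odd \<open>N\<close>) with arbitrary \<open>u\<^sub>i\<close>, which by the fundamental
  theorem of algebra is an arbitrary palindromic polynomial; the entries of \<open>B\<close> then give
  the \<open>X\<^sub>p\<close> arbitrary nonzero values. So no nonzero polynomial vanishes on all values of the
  functions.\<close>

subsection \<open>Brackets of the coordinate functions\<close>

text \<open>\<open>deriv\<close> is total, so sums and products of brackets behave well only where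
  derivatives exist; every calculation therefore carries the derivatives along the coordinate lines.
  The one ingredient that is not polynomial is S. Instead of differentiating the inverse of B, a
  closed formula for the brackets of the entries of S is checked against the Leibniz rule for S B =
  A^T, and invertibility of B leaves no other value. The weights come from the diagonal value 1 of
  \<open>theta\<close>: every index of the entry that meets the rows or columns of the minor counts
  1 up to sign. The independence proof needs no Jacobian, since the two families decouple: the Y_p
  see only A, and once A is fixed the X_p are steered by B. They depend on the squares of the
  partial products of its entries, so square roots enter.\<close>

lemma tindex_less:
  fixes i k N :: nat
  assumes "i < N" "k < N"
  shows "i * N + k < N * N"
proof -
  have "i * N + k < Suc i * N"
    using assms by simp
  also have "\<dots> \<le> N * N"
    using assms by (intro mult_le_mono1) simp
  finally show ?thesis .
qed

lemma sum_square_divmod: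
  fixes f :: "nat \<Rightarrow> nat \<Rightarrow> 'a::comm_monoid_add"
  shows "(\<Sum>c<N * N. f (c div N) (c mod N)) = (\<Sum>a<N. \<Sum>b<N. f a b)"
proof -
  have "(\<Sum>a<N. \<Sum>b<N. f a b) = (\<Sum>(a, b)\<in>{..<N} \<times> {..<N}. f a b)"
    by (simp add: sum.cartesian_product)
  also have "\<dots> = (\<Sum>c<N * N. f (c div N) (c mod N))"
    by (cases "N = 0", simp, rule sum.reindex_bij_witness[where j = "\<lambda>(a, b). a * N + b"
          and i = "\<lambda>c. (c div N, c mod N)"])
      (auto simp: tindex_less less_mult_imp_div_less)
  finally show ?thesis ..
qed

definition theta :: "nat \<Rightarrow> nat \<Rightarrow> complex" where
  "theta i j = (if i = j then 1 else if j < i then 2 else 0)"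

lemma theta_refl [simp]: "theta i i = 1"
  by (simp add: theta_def)

lemma theta_less [simp]: "i < j \<Longrightarrow> theta i j = 0"
  by (simp add: theta_def)

text \<open>The r-matrix plus its flip is twice the permutation of the tensor factors. This is what
  reconciles the two index orders when the brackets of S are checked.\<close>

lemma theta_flip: "theta j i = 2 - theta i j"
  by (simp add: theta_def)

context
  fixes N i j k l :: nat
  assumes ijkl: "i < N" "j < N" "k < N" "l < N"
begin

lemma tcoeff_tensor: "tcoeff N (tensor N X Y) i j k l = X $$ (i, j) * Y $$ (k, l)"
  using ijkl by (simp add: tcoeff_def tensor_def tindex_less)

lemma tcoeff_transpose1: "tcoeff N (transpose1 N T) i j k l = tcoeff N T j i k l"
  using ijkl by (simp add: tcoeff_def transpose1_def tindex_less)

lemma tcoeff_transpose2: "tcoeff N (transpose2 N T) i j k l = tcoeff N T i j l k"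
  using ijkl by (simp add: tcoeff_def transpose2_def tindex_less)

lemma tcoeff_mult:
  assumes "T \<in> carrier_mat (N * N) (N * N)" "U \<in> carrier_mat (N * N) (N * N)"
  shows "tcoeff N (T * U) i j k l = (\<Sum>a<N. \<Sum>b<N. tcoeff N T i a k b * tcoeff N U a j b l)"
proof -
  have "tcoeff N (T * U) i j k l
      = (\<Sum>c<N * N. T $$ (i * N + k, c) * U $$ (c, j * N + l))"
    using assms ijkl
    by (simp add: tcoeff_def times_mat_def scalar_prod_def tindex_less atLeast0LessThan)
  also have "\<dots> = (\<Sum>c<N * N. T $$ (i * N + k, c div N * N + c mod N)
      * U $$ (c div N * N + c mod N, j * N + l))"
    by simp
  finally show ?thesis
    by (subst (asm) sum_square_divmod) (simp add: tcoeff_def)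
qed

lemma tcoeff_r_matrix: "tcoeff N (r_matrix N) i j k l = (if i = l \<and> j = k then theta i j else 0)"
proof -
  have "(\<Sum>a<N. tcoeff N (tensor N (mat_unit N a a) (mat_unit N a a)) i j k l)
      = (\<Sum>a<N. if a = i then (if i = l \<and> j = k \<and> i = j then 1 else 0) else 0)"
    using ijkl by (intro sum.cong) (auto simp: tcoeff_tensor mat_unit_def)
  then have diag: "(\<Sum>a<N. tcoeff N (tensor N (mat_unit N a a) (mat_unit N a a)) i j k l)
      = (if i = l \<and> j = k \<and> i = j then 1 else 0)"
    using ijkl by simp
  have "(\<Sum>a<N. \<Sum>b<a. tcoeff N (tensor N (mat_unit N a b) (mat_unit N b a)) i j k l)
      = (\<Sum>a<N. \<Sum>b<a. if b = j then (if a = i \<and> i = l \<and> j = k then 1 else 0) else 0)"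
    using ijkl by (intro sum.cong) (auto simp: tcoeff_tensor mat_unit_def)
  also have "\<dots> = (\<Sum>a<N. if a = i then (if j < i \<and> i = l \<and> j = k then 1 else 0) else 0)"
    by (intro sum.cong) auto
  also have "\<dots> = (if j < i \<and> i = l \<and> j = k then 1 else 0)"
    using ijkl by simp
  finally have "tcoeff N (r_matrix N) i j k l = (if i = l \<and> j = k \<and> i = j then 1 else 0)
      + 2 * (if j < i \<and> i = l \<and> j = k then 1 else 0)"
    using diag ijkl by (simp add: tcoeff_def r_matrix_def tindex_less)
  then show ?thesis
    by (cases "i = l \<and> j = k") (auto simp: theta_def)
qed

end

lemma tensor_carrier [simp]:
  "tensor N X Y \<in> carrier_mat (N * N) (N * N)"
  "in_first N X \<in> carrier_mat (N * N) (N * N)"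
  "in_second N X \<in> carrier_mat (N * N) (N * N)"
  "transpose1 N T \<in> carrier_mat (N * N) (N * N)"
  "transpose2 N T \<in> carrier_mat (N * N) (N * N)"
  "r_matrix N \<in> carrier_mat (N * N) (N * N)"
  by (auto simp: tensor_def in_first_def in_second_def transpose1_def transpose2_def r_matrix_def)

context
  fixes N i j k l :: nat and T :: "complex mat"
  assumes ijkl: "i < N" "j < N" "k < N" "l < N"
    and T: "T \<in> carrier_mat (N * N) (N * N)"
begin

lemma tcoeff_mult_in_first:
  "tcoeff N (T * in_first N X) i j k l = (\<Sum>a<N. tcoeff N T i a k l * X $$ (a, j))"
  using ijkl T
  by (simp add: tcoeff_mult in_first_def tcoeff_tensor if_distrib[of "\<lambda>x. _ * x"] cong: if_cong)

lemma tcoeff_mult_in_second: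
  "tcoeff N (T * in_second N X) i j k l = (\<Sum>b<N. tcoeff N T i j k b * X $$ (b, l))"
proof -
  have "tcoeff N (T * in_second N X) i j k l
      = (\<Sum>a<N. if a = j then \<Sum>b<N. tcoeff N T i j k b * X $$ (b, l) else 0)"
    unfolding tcoeff_mult[OF ijkl T tensor_carrier(3)]
    using ijkl by (intro sum.cong[OF refl]) (simp add: in_second_def tcoeff_tensor)
  then show ?thesis
    using ijkl by simp
qed

lemma tcoeff_in_first_mult:
  "tcoeff N (in_first N X * T) i j k l = (\<Sum>a<N. X $$ (i, a) * tcoeff N T a j k l)"
  using ijkl T
  by (simp add: tcoeff_mult in_first_def tcoeff_tensor if_distrib[of "\<lambda>x. x * _"] if_distrib[of "\<lambda>x. _ * x"] cong: if_cong)

lemma tcoeff_in_second_mult: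
  "tcoeff N (in_second N X * T) i j k l = (\<Sum>b<N. X $$ (k, b) * tcoeff N T i j b l)"
proof -
  have "tcoeff N (in_second N X * T) i j k l
      = (\<Sum>a<N. if a = i then \<Sum>b<N. X $$ (k, b) * tcoeff N T i j b l else 0)"
    unfolding tcoeff_mult[OF ijkl tensor_carrier(3) T]
    using ijkl by (intro sum.cong[OF refl]) (simp add: in_second_def tcoeff_tensor)
  then show ?thesis
    using ijkl by simp
qed

end

lemma if_conj_zero: "(if P \<and> Q then x else 0) = (if P then if Q then x else 0 else 0)"
  by simp

lemma sum_if_const: "(\<Sum>b\<in>S. if P then f b else 0) = (if P then sum f S else 0)"
  by simp

context
  fixes N i j k l :: nat and X Y :: "complex mat"
  assumes ijkl: "i < N" "j < N" "k < N" "l < N"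
begin

lemmas tcoeff_simps = tcoeff_mult_in_first tcoeff_mult_in_second
  tcoeff_in_first_mult tcoeff_in_second_mult tcoeff_r_matrix tcoeff_transpose1 tcoeff_transpose2
  mult_carrier_mat[of _ "N * N" "N * N"] if_conj_zero sum_if_const
  if_distrib[of "\<lambda>x. x * _"] if_distrib[of "\<lambda>x. _ * x"]

text \<open>Since r is supported on the units E_ij tensor E_ji, one term of each sum survives and
  two indices trade places. All three brackets are combinations of these five products.\<close>

lemma tcoeff_r_matrix_products:
  "tcoeff N (r_matrix N * in_first N X * in_second N Y) i j k l
     = theta i k * X $$ (k, j) * Y $$ (i, l)"
  "tcoeff N (in_first N X * in_second N Y * r_matrix N) i j k l
     = theta l j * X $$ (i, l) * Y $$ (k, j)"
  "tcoeff N (in_first N X * transpose1 N (r_matrix N) * in_second N Y) i j k l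
     = theta j k * X $$ (i, k) * Y $$ (j, l)"
  "tcoeff N (in_second N Y * transpose1 N (r_matrix N) * in_first N X) i j k l
     = theta l i * X $$ (l, j) * Y $$ (k, i)"
  "tcoeff N (in_first N X * transpose2 N (r_matrix N) * in_second N Y) i j k l
     = theta k j * X $$ (i, k) * Y $$ (j, l)"
proof -
  \<comment> \<open>Here the last factor is r itself, so the rules for multiplication by
    \<open>in_first\<close> or \<open>in_second\<close> do not fit and the general product formula
    is used.\<close>
  have "tcoeff N (in_first N X * in_second N Y * r_matrix N) i j k l =
     (\<Sum>a<N. \<Sum>b<N. X $$ (i, a) * Y $$ (k, b) * tcoeff N (r_matrix N) a j b l)"
    using ijkl by (subst tcoeff_mult) (simp_all add: tcoeff_mult_in_second mult_carrier_mat[of _ "N * N" "N * N"]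
       in_first_def tcoeff_tensor if_distrib[of "\<lambda>x. x * _"] if_distrib[of "\<lambda>x. _ * x"] cong: if_cong)
  then show "tcoeff N (in_first N X * in_second N Y * r_matrix N) i j k l
     = theta l j * X $$ (i, l) * Y $$ (k, j)"
    using ijkl by (simp add: tcoeff_r_matrix if_distrib[of "\<lambda>x. _ * x"]
        conj_commute[of "_ = l"] if_conj_zero[of "j = _"] cong: if_cong)
qed (use ijkl in \<open>simp_all add: tcoeff_simps cong: if_cong\<close>)

end

lemma tcoeff_linear:
  assumes "i < N" "j < N" "k < N" "l < N"
    and "T \<in> carrier_mat (N * N) (N * N)" "U \<in> carrier_mat (N * N) (N * N)"
  shows "tcoeff N (T + U) i j k l = tcoeff N T i j k l + tcoeff N U i j k l"
    "tcoeff N (T - U) i j k l = tcoeff N T i j k l - tcoeff N U i j k l"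
  using assms by (auto simp: tcoeff_def tindex_less)

lemma tcoeff_uminus:
  assumes "i < N" "j < N" "k < N" "l < N" "T \<in> carrier_mat (N * N) (N * N)"
  shows "tcoeff N (- T) i j k l = - tcoeff N T i j k l"
  using assms by (auto simp: tcoeff_def tindex_less)

context
  fixes N i j k l :: nat and A B :: "complex mat"
  assumes ijkl: "i < N" "j < N" "k < N" "l < N"
begin

lemma coord_bracket_AA:
  "coord_bracket N (EntA i j) (EntA k l) (A, B) =
     theta i k * A $$ (k, j) * A $$ (i, l) - theta l j * A $$ (i, l) * A $$ (k, j)
     + theta j k * A $$ (i, k) * A $$ (j, l) - theta l i * A $$ (l, j) * A $$ (k, i)"
  using ijkl
  by (simp add: bracket_AA_def Let_def tcoeff_linear tcoeff_uminus tcoeff_r_matrix_products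
      mult_carrier_mat[of _ "N * N" "N * N"] minus_carrier_mat[of _ "N * N" "N * N"] )

lemma coord_bracket_BB:
  "coord_bracket N (EntB i j) (EntB k l) (A, B) =
     (theta i k - theta l j) * B $$ (k, j) * B $$ (i, l)"
  using ijkl
  by (simp add: bracket_BB_def Let_def tcoeff_linear tcoeff_uminus tcoeff_r_matrix_products
      mult_carrier_mat[of _ "N * N" "N * N"] minus_carrier_mat[of _ "N * N" "N * N"] algebra_simps)

lemma coord_bracket_BA:
  "coord_bracket N (EntB i j) (EntA k l) (A, B) =
     - theta k j * B $$ (i, k) * A $$ (j, l) - theta l j * B $$ (i, l) * A $$ (k, j)"
  using ijkl
  by (simp add: bracket_BA_def Let_def tcoeff_linear tcoeff_uminus tcoeff_r_matrix_products
      mult_carrier_mat[of _ "N * N" "N * N"] minus_carrier_mat[of _ "N * N" "N * N"] )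

end

lemma coord_bracket_AB:
  assumes "i < N" "j < N" "k < N" "l < N"
  shows "coord_bracket N (EntA i j) (EntB k l) (A, B) =
     theta i l * B $$ (k, i) * A $$ (l, j) + theta j l * B $$ (k, j) * A $$ (i, l)"
  using coord_bracket_BA[OF assms(3,4,1,2), of A B] by simp

subsection \<open>The bracket as a derivation\<close>

definition points :: "nat \<Rightarrow> point set" where
  "points N = carrier_mat N N \<times> carrier_mat N N"

fun shift :: "nat \<Rightarrow> coord \<Rightarrow> complex \<Rightarrow> point \<Rightarrow> point" where
  "shift N (EntA i j) t (A, B) = (A + t \<cdot>\<^sub>m mat_unit N i j, B)"
| "shift N (EntB i j) t (A, B) = (A, B + t \<cdot>\<^sub>m mat_unit N i j)"

lemma pderiv_at_eq: "pderiv_at N u f x = deriv (\<lambda>t. f (shift N u t x)) 0"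
  by (cases u; cases x) simp_all

lemma finite_coords [simp]: "finite (coords N)"
proof -
  have "coords N = case_prod EntA ` ({..<N} \<times> {..<N}) \<union> case_prod EntB ` ({..<N} \<times> {..<N})"
    by (auto simp: coords_def)
  then show ?thesis
    by simp
qed

lemma coords_iff [simp]:
  "EntA i j \<in> coords N \<longleftrightarrow> i < N \<and> j < N"
  "EntB i j \<in> coords N \<longleftrightarrow> i < N \<and> j < N"
  by (auto simp: coords_def)

lemma coords_cases:
  assumes "u \<in> coords N"
  obtains i j where "u = EntA i j" "i < N" "j < N" | i j where "u = EntB i j" "i < N" "j < N"
  using assms by (auto simp: coords_def)

lemma shift_points:
  assumes "x \<in> points N"
  shows "shift N u t x \<in> points N"
  using assms by (cases u; cases x) (auto simp: points_def mat_unit_def)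

lemma shift_0:
  assumes "x \<in> points N"
  shows "shift N u 0 x = x"
  using assms by (cases u; cases x) (auto simp: points_def mat_unit_def intro!: eq_matI)

lemma entry_shift:
  assumes "x \<in> points N" "u \<in> coords N" "v \<in> coords N"
  shows "entry v (shift N u t x) = entry v x + (if u = v then t else 0)"
  using assms
  by (cases x; elim coords_cases) (auto simp: points_def mat_unit_def)

text \<open>With the entries as a family \<open>F\<close>, one formula serves for differentiating a
  determinant, for its rationality and for evaluating a determinant of polynomials.\<close>

lemma det_mat_leibniz:
  "det (mat n n (\<lambda>(i, j). F i j))
     = (\<Sum>p | p permutes {0..<n}. signof p * (\<Prod>i = 0..<n. F i (p i)))"
proof -
  have "(\<Prod>i = 0..<n. mat n n (\<lambda>(i, j). F i j) $$ (i, p i)) = (\<Prod>i = 0..<n. F i (p i))"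
    if "p permutes {0..<n}" for p
    using that permutes_in_image[of p "{0..<n}"] by (intro prod.cong) auto
  then show ?thesis
    by (auto simp: det_def intro!: sum.cong)
qed

text \<open>\<open>d\<close> is the bracket of \<open>f\<close> with the coordinate \<open>w\<close>
  at \<open>x\<close>. Existence of the derivatives is part of the notion, because
  \<open>deriv\<close> has a junk value elsewhere and the Leibniz rule would fail.\<close>

definition has_bracket ::
    "nat \<Rightarrow> point \<Rightarrow> coord \<Rightarrow> (point \<Rightarrow> complex) \<Rightarrow> complex \<Rightarrow> bool" where
  "has_bracket N x w f d \<longleftrightarrow>
     (\<exists>D. (\<forall>u\<in>coords N. ((\<lambda>t. f (shift N u t x)) has_field_derivative D u) (at 0)) \<and>
        d = (\<Sum>u\<in>coords N. D u * coord_bracket N u w x))"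

text \<open>A log-canonical bracket {f, w} = c f w. Weights add under products and change sign under
  inverses, so a Casimir function shows as total weight 0.\<close>

definition has_weight ::
    "nat \<Rightarrow> point \<Rightarrow> coord \<Rightarrow> (point \<Rightarrow> complex) \<Rightarrow> complex \<Rightarrow> bool" where
  "has_weight N x w f c \<longleftrightarrow> has_bracket N x w f (c * f x * entry w x)"

lemma has_bracket_unique:
  assumes "has_bracket N x w f d" "has_bracket N x w f e"
  shows "d = e"
proof -
  obtain D where D: "\<And>u. u \<in> coords N \<Longrightarrow> ((\<lambda>t. f (shift N u t x)) has_field_derivative D u) (at 0)"
      "d = (\<Sum>u\<in>coords N. D u * coord_bracket N u w x)"
    using assms by (auto simp: has_bracket_def)
  obtain E where E: "\<And>u. u \<in> coords N \<Longrightarrow> ((\<lambda>t. f (shift N u t x)) has_field_derivative E u) (at 0)"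
      "e = (\<Sum>u\<in>coords N. E u * coord_bracket N u w x)"
    using assms by (auto simp: has_bracket_def)
  show ?thesis
    unfolding D(2) E(2) by (intro sum.cong refl) (simp add: DERIV_unique[OF D(1) E(1)])
qed

text \<open>Agreement near the point is enough. This matters for S, whose identities hold only where
  B is invertible.\<close>

lemma has_bracket_eventually_cong:
  assumes "has_bracket N x w f d"
    and "\<And>u. u \<in> coords N \<Longrightarrow> eventually (\<lambda>t. f (shift N u t x) = g (shift N u t x)) (nhds 0)"
  shows "has_bracket N x w g d"
proof -
  obtain D where D: "\<And>u. u \<in> coords N \<Longrightarrow> ((\<lambda>t. f (shift N u t x)) has_field_derivative D u) (at 0)"
      "d = (\<Sum>u\<in>coords N. D u * coord_bracket N u w x)"
    using assms by (auto simp: has_bracket_def)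
  then show ?thesis
    unfolding has_bracket_def using DERIV_cong_ev[OF refl assms(2) refl] by blast
qed

lemma has_bracket_cong:
  assumes "has_bracket N x w f d" "x \<in> points N" "\<And>y. y \<in> points N \<Longrightarrow> f y = g y"
  shows "has_bracket N x w g d"
  by (rule has_bracket_eventually_cong[OF assms(1)])
    (simp add: assms(3) shift_points[OF assms(2)])

lemma has_bracket_const: "has_bracket N x w (\<lambda>_. c) 0"
  unfolding has_bracket_def by (intro exI[of _ "\<lambda>_. 0"]) simp

lemma has_bracket_add:
  assumes "has_bracket N x w f d" "has_bracket N x w g e"
  shows "has_bracket N x w (\<lambda>y. f y + g y) (d + e)"
proof -
  obtain D where D: "\<And>u. u \<in> coords N \<Longrightarrow> ((\<lambda>t. f (shift N u t x)) has_field_derivative D u) (at 0)"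
      "d = (\<Sum>u\<in>coords N. D u * coord_bracket N u w x)"
    using assms by (auto simp: has_bracket_def)
  obtain E where E: "\<And>u. u \<in> coords N \<Longrightarrow> ((\<lambda>t. g (shift N u t x)) has_field_derivative E u) (at 0)"
      "e = (\<Sum>u\<in>coords N. E u * coord_bracket N u w x)"
    using assms by (auto simp: has_bracket_def)
  show ?thesis
    unfolding has_bracket_def D(2) E(2)
    by (intro exI[of _ "\<lambda>u. D u + E u"])
      (auto intro!: DERIV_add D(1) E(1) simp: sum.distrib algebra_simps)
qed

lemma has_bracket_sum:
  assumes "finite I" "\<And>i. i \<in> I \<Longrightarrow> has_bracket N x w (f i) (d i)"
  shows "has_bracket N x w (\<lambda>y. \<Sum>i\<in>I. f i y) (\<Sum>i\<in>I. d i)"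
  using assms by (induction I) (auto intro: has_bracket_const has_bracket_add)

text \<open>The partial derivatives of a coordinate function are Kronecker deltas, which collapse
  the inner sum of \<open>bracket\<close>.\<close>

lemma bracket_entry:
  assumes "has_bracket N x w f d" "x \<in> points N" "w \<in> coords N"
  shows "bracket N f (entry w) x = d"
proof -
  obtain D where D: "\<And>u. u \<in> coords N \<Longrightarrow> ((\<lambda>t. f (shift N u t x)) has_field_derivative D u) (at 0)"
      "d = (\<Sum>u\<in>coords N. D u * coord_bracket N u w x)"
    using assms by (auto simp: has_bracket_def)
  have pw: "pderiv_at N v (entry w) x = (if v = w then 1 else 0)" if "v \<in> coords N" for v
  proof -
    have "((\<lambda>t. entry w (shift N v t x)) has_field_derivative (if v = w then 1 else 0)) (at 0)"
      using assms that by (auto simp: entry_shift intro!: derivative_eq_intros)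
    then show ?thesis
      by (simp add: pderiv_at_eq DERIV_imp_deriv)
  qed
  have pf: "pderiv_at N u f x = D u" if "u \<in> coords N" for u
    by (simp add: pderiv_at_eq DERIV_imp_deriv[OF D(1)[OF that]])
  have "bracket N f (entry w) x
      = (\<Sum>u\<in>coords N. \<Sum>v\<in>coords N. if v = w then D u * coord_bracket N u w x else 0)"
    unfolding bracket_def
    by (intro sum.cong refl) (simp add: pw pf)
  also have "\<dots> = d"
    using assms by (simp add: D(2))
  finally show ?thesis .
qed

context
  fixes N :: nat and x :: point and w :: coord
  assumes x: "x \<in> points N" and w: "w \<in> coords N"
begin

lemma has_bracket_entry:
  assumes "v \<in> coords N"
  shows "has_bracket N x w (entry v) (coord_bracket N v w x)"
  unfolding has_bracket_def
proof (intro exI[of _ "\<lambda>u. if u = v then 1 else 0"] conjI ballI)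
  fix u assume "u \<in> coords N"
  then show "((\<lambda>t. entry v (shift N u t x)) has_field_derivative (if u = v then 1 else 0)) (at 0)"
    using assms x by (auto simp: entry_shift intro!: derivative_eq_intros)
qed (use assms in \<open>simp add: if_distrib[of "\<lambda>x. x * _"] cong: if_cong\<close>)

lemma has_bracket_mult:
  assumes "has_bracket N x w f d" "has_bracket N x w g e"
  shows "has_bracket N x w (\<lambda>y. f y * g y) (d * g x + f x * e)"
proof -
  obtain D where D: "\<And>u. u \<in> coords N \<Longrightarrow> ((\<lambda>t. f (shift N u t x)) has_field_derivative D u) (at 0)"
      "d = (\<Sum>u\<in>coords N. D u * coord_bracket N u w x)"
    using assms by (auto simp: has_bracket_def)
  obtain E where E: "\<And>u. u \<in> coords N \<Longrightarrow> ((\<lambda>t. g (shift N u t x)) has_field_derivative E u) (at 0)"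
      "e = (\<Sum>u\<in>coords N. E u * coord_bracket N u w x)"
    using assms by (auto simp: has_bracket_def)
  show ?thesis
    unfolding has_bracket_def D(2) E(2)
  proof (intro exI[of _ "\<lambda>u. D u * g x + f x * E u"] conjI ballI)
    fix u assume "u \<in> coords N"
    from DERIV_mult[OF D(1) E(1), OF this this]
    show "((\<lambda>t. f (shift N u t x) * g (shift N u t x)) has_field_derivative D u * g x + f x * E u) (at 0)"
      by (simp add: shift_0[OF x] algebra_simps)
  qed (simp add: sum.distrib sum_distrib_left sum_distrib_right algebra_simps)
qed

lemma has_bracket_inverse:
  assumes "has_bracket N x w f d" "f x \<noteq> 0"
  shows "has_bracket N x w (\<lambda>y. inverse (f y)) (- (d / (f x)\<^sup>2))"
proof -
  obtain D where D: "\<And>u. u \<in> coords N \<Longrightarrow> ((\<lambda>t. f (shift N u t x)) has_field_derivative D u) (at 0)"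
      "d = (\<Sum>u\<in>coords N. D u * coord_bracket N u w x)"
    using assms by (auto simp: has_bracket_def)
  show ?thesis
    unfolding has_bracket_def D(2)
  proof (intro exI[of _ "\<lambda>u. - (D u / (f x)\<^sup>2)"] conjI ballI)
    fix u assume u: "u \<in> coords N"
    have "((\<lambda>t. inverse (f (shift N u t x))) has_field_derivative
        - (inverse (f (shift N u 0 x)) * D u * inverse (f (shift N u 0 x)))) (at 0)"
      by (rule DERIV_inverse'[OF D(1)[OF u]]) (simp add: shift_0[OF x] assms)
    then show "((\<lambda>t. inverse (f (shift N u t x))) has_field_derivative - (D u / (f x)\<^sup>2)) (at 0)"
      by (simp add: shift_0[OF x] field_simps power2_eq_square)
  qed (simp add: sum_divide_distrib sum_negf)
qed

lemma has_bracket_cmult: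
  assumes "has_bracket N x w f d"
  shows "has_bracket N x w (\<lambda>y. c * f y) (c * d)"
  using has_bracket_mult[OF has_bracket_const assms, of c] by simp

lemma has_bracket_prod:
  assumes "finite I" "\<And>i. i \<in> I \<Longrightarrow> has_bracket N x w (f i) (d i)"
  shows "has_bracket N x w (\<lambda>y. \<Prod>i\<in>I. f i y) (\<Sum>i\<in>I. d i * (\<Prod>j\<in>I - {i}. f j x))"
  using assms
proof (induction I)
  case empty
  then show ?case
    using has_bracket_const by simp
next
  case (insert a I)
  have "(\<Sum>i\<in>I. d i * (\<Prod>j\<in>insert a I - {i}. f j x))
      = (\<Sum>i\<in>I. f a x * (d i * (\<Prod>j\<in>I - {i}. f j x)))"
  proof (intro sum.cong refl)
    fix i assume "i \<in> I"
    then have "insert a I - {i} = insert a (I - {i})"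
      using insert by auto
    then show "d i * (\<Prod>j\<in>insert a I - {i}. f j x) = f a x * (d i * (\<Prod>j\<in>I - {i}. f j x))"
      using insert by (simp add: ac_simps)
  qed
  then show ?case
    using insert.hyps insert.prems has_bracket_mult[of "f a" "d a", OF _ insert.IH]
    by (simp add: sum_distrib_left)
qed

text \<open>Jacobi's formula. The product rule in the Leibniz expansion yields determinants
  \<open>R i\<close> with row i replaced by its brackets; expanding along that row involves only
  cofactors that do not see the replacement.\<close>

lemma has_bracket_det:
  assumes d: "\<And>i j. i < n \<Longrightarrow> j < n \<Longrightarrow> has_bracket N x w (F i j) (d i j)"
  shows "has_bracket N x w (\<lambda>y. det (mat n n (\<lambda>(i, j). F i j y)))
    (\<Sum>i<n. \<Sum>j<n. cofactor (mat n n (\<lambda>(i, j). F i j x)) i j * d i j)"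
proof -
  let ?S = "{p. p permutes {0..<n}}"
  define M where "M = mat n n (\<lambda>(i, j). F i j x)"
  define R where "R i = mat n n (\<lambda>(k, j). if k = i then d i j else F k j x)" for i
  have F: "has_bracket N x w (F i (p i)) (d i (p i))" if "p \<in> ?S" "i \<in> {0..<n}" for p i
    using d that permutes_in_image[of p "{0..<n}" i] by simp
  have "has_bracket N x w (\<lambda>y. det (mat n n (\<lambda>(i, j). F i j y)))
      (\<Sum>p\<in>?S. signof p * (\<Sum>i = 0..<n. d i (p i) * (\<Prod>k\<in>{0..<n} - {i}. F k (p k) x)))"
    unfolding det_mat_leibniz
    by (intro has_bracket_sum has_bracket_cmult has_bracket_prod F finite_permutations) auto
  also have "(\<Sum>p\<in>?S. signof p * (\<Sum>i = 0..<n. d i (p i) * (\<Prod>k\<in>{0..<n} - {i}. F k (p k) x)))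
      = (\<Sum>i = 0..<n. \<Sum>p\<in>?S. signof p * (d i (p i) * (\<Prod>k\<in>{0..<n} - {i}. F k (p k) x)))"
    unfolding sum_distrib_left by (rule sum.swap)
  also have "\<dots> = (\<Sum>i<n. det (R i))"
  proof -
    have "(\<Prod>k = 0..<n. if k = i then d i (p k) else F k (p k) x)
        = d i (p i) * (\<Prod>k\<in>{0..<n} - {i}. F k (p k) x)" if "i < n" for i p
      using that by (subst prod.remove[of _ i]) (auto intro!: prod.cong)
    then show ?thesis
      unfolding R_def det_mat_leibniz by (auto simp: atLeast0LessThan intro!: sum.cong)
  qed
  also have "\<dots> = (\<Sum>i<n. \<Sum>j<n. cofactor M i j * d i j)"
  proof (intro sum.cong refl)
    fix i assume "i \<in> {..<n}"
    then have i: "i < n" by simp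
    have R: "R i \<in> carrier_mat n n"
      by (simp add: R_def)
    have "cofactor (R i) i j = cofactor M i j" if "j < n" for j
    proof -
      have "mat_delete (R i) i j = mat_delete M i j"
        using that i by (auto simp: mat_delete_def R_def M_def intro!: eq_matI)
      then show ?thesis
        by (simp add: cofactor_def)
    qed
    then show "det (R i) = (\<Sum>j<n. cofactor M i j * d i j)"
      unfolding laplace_expansion_row[OF R i] using i by (intro sum.cong) (auto simp: R_def)
  qed
  finally show ?thesis
    by (simp add: M_def)
qed

lemma has_weight_mult:
  assumes "has_weight N x w f c" "has_weight N x w g e"
  shows "has_weight N x w (\<lambda>y. f y * g y) (c + e)"
  using has_bracket_mult[OF assms[unfolded has_weight_def]]
  by (simp add: has_weight_def algebra_simps)

lemma has_weight_inverse:
  assumes "has_weight N x w f c" "f x \<noteq> 0"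
  shows "has_weight N x w (\<lambda>y. inverse (f y)) (- c)"
  using has_bracket_inverse[OF assms[unfolded has_weight_def]] assms(2)
  by (simp add: has_weight_def field_simps power2_eq_square)

text \<open>A common weight survives linear combinations; this carries the weight from values of a
  polynomial in w to its coefficients.\<close>

lemma has_weight_linear_combination:
  fixes a :: "'i \<Rightarrow> complex"
  assumes "finite I" "\<And>i. i \<in> I \<Longrightarrow> has_weight N x w (f i) c"
  shows "has_weight N x w (\<lambda>y. \<Sum>i\<in>I. a i * f i y) c"
proof -
  have "has_bracket N x w (\<lambda>y. \<Sum>i\<in>I. a i * f i y) (\<Sum>i\<in>I. a i * (c * f i x * entry w x))"
    using assms by (intro has_bracket_sum has_bracket_cmult) (auto simp: has_weight_def)
  then show ?thesis
    by (simp add: has_weight_def sum_distrib_left sum_distrib_right ac_simps)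
qed

end

subsection \<open>Rational functions\<close>

definition monomial :: "('v \<Rightarrow>\<^sub>0 nat) \<Rightarrow> ('v \<Rightarrow> complex) \<Rightarrow> complex" where
  "monomial m x = (\<Prod>v\<in>Poly_Mapping.keys m. x v ^ Poly_Mapping.lookup m v)"

lemma monomial_superset:
  assumes "finite V" "Poly_Mapping.keys m \<subseteq> V"
  shows "monomial m x = (\<Prod>v\<in>V. x v ^ Poly_Mapping.lookup m v)"
  unfolding monomial_def using assms
  by (intro prod.mono_neutral_left) (auto simp: in_keys_iff)

lemma monomial_add: "monomial (m + n) x = monomial m x * monomial n x"
proof -
  let ?V = "Poly_Mapping.keys m \<union> Poly_Mapping.keys n"
  have "monomial (m + n) x = (\<Prod>v\<in>?V. x v ^ Poly_Mapping.lookup (m + n) v)"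
    using Poly_Mapping.keys_add[of m n] by (intro monomial_superset) auto
  moreover have "monomial m x = (\<Prod>v\<in>?V. x v ^ Poly_Mapping.lookup m v)"
    "monomial n x = (\<Prod>v\<in>?V. x v ^ Poly_Mapping.lookup n v)"
    by (auto intro!: monomial_superset)
  ultimately show ?thesis
    by (simp add: lookup_add power_add prod.distrib)
qed

lemma cpoly_eval_superset:
  assumes "finite S" "Poly_Mapping.keys P \<subseteq> S"
  shows "cpoly_eval P x = (\<Sum>m\<in>S. Poly_Mapping.lookup P m * monomial m x)"
  unfolding cpoly_eval_def monomial_def using assms
  by (intro sum.mono_neutral_left) (auto simp: in_keys_iff)

text \<open>Closure properties are proved for functions, so that formal polynomials need not be
  manipulated when determinants are shown to be rational.\<close>

definition polynomial_fun :: "nat \<Rightarrow> (point \<Rightarrow> complex) \<Rightarrow> bool" where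
  "polynomial_fun N f \<longleftrightarrow>
     (\<exists>P. cpoly_vars P \<subseteq> coords N \<and> (\<forall>x. cpoly_eval P (\<lambda>u. entry u x) = f x))"

lemma polynomial_fun_monomial:
  assumes "Poly_Mapping.keys m \<subseteq> coords N"
  shows "polynomial_fun N (\<lambda>x. c * monomial m (\<lambda>u. entry u x))"
  unfolding polynomial_fun_def
proof (intro exI[of _ "Poly_Mapping.single m c"] conjI allI)
  show "cpoly_vars (Poly_Mapping.single m c) \<subseteq> coords N"
    using assms by (auto simp: cpoly_vars_def split: if_splits)
  show "cpoly_eval (Poly_Mapping.single m c) (\<lambda>u. entry u x) = c * monomial m (\<lambda>u. entry u x)" for x
    by (subst cpoly_eval_superset[of "{m}"]) auto
qed

lemma polynomial_fun_const: "polynomial_fun N (\<lambda>x. c)"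
  using polynomial_fun_monomial[of 0 N c] by (simp add: monomial_def)

lemma polynomial_fun_entry:
  assumes "v \<in> coords N"
  shows "polynomial_fun N (entry v)"
  using polynomial_fun_monomial[of "Poly_Mapping.single v 1" N 1] assms
  by (simp add: monomial_def)

lemma polynomial_fun_add:
  assumes "polynomial_fun N f" "polynomial_fun N g"
  shows "polynomial_fun N (\<lambda>x. f x + g x)"
proof -
  obtain P Q where P: "cpoly_vars P \<subseteq> coords N" "\<And>x. cpoly_eval P (\<lambda>u. entry u x) = f x"
    and Q: "cpoly_vars Q \<subseteq> coords N" "\<And>x. cpoly_eval Q (\<lambda>u. entry u x) = g x"
    using assms by (auto simp: polynomial_fun_def)
  let ?S = "Poly_Mapping.keys P \<union> Poly_Mapping.keys Q"
  have sub: "Poly_Mapping.keys (P + Q) \<subseteq> ?S"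
    by (rule Poly_Mapping.keys_add)
  have "cpoly_vars (P + Q) \<subseteq> coords N"
    using sub P(1) Q(1) unfolding cpoly_vars_def by blast
  moreover have "cpoly_eval (P + Q) y = cpoly_eval P y + cpoly_eval Q y" for y
    using sub by (simp add: cpoly_eval_superset[of ?S] lookup_add distrib_right sum.distrib)
  ultimately show ?thesis
    using P(2) Q(2) by (auto simp: polynomial_fun_def intro!: exI[of _ "P + Q"])
qed

lemma polynomial_fun_sum:
  assumes "\<And>i. i \<in> I \<Longrightarrow> polynomial_fun N (f i)"
  shows "polynomial_fun N (\<lambda>x. \<Sum>i\<in>I. f i x)"
  using assms
  by (induction I rule: infinite_finite_induct) (auto intro: polynomial_fun_const polynomial_fun_add)

lemma polynomial_fun_mult:
  assumes "polynomial_fun N f" "polynomial_fun N g"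
  shows "polynomial_fun N (\<lambda>x. f x * g x)"
proof -
  obtain P Q where P: "cpoly_vars P \<subseteq> coords N" "\<And>x. cpoly_eval P (\<lambda>u. entry u x) = f x"
    and Q: "cpoly_vars Q \<subseteq> coords N" "\<And>x. cpoly_eval Q (\<lambda>u. entry u x) = g x"
    using assms by (auto simp: polynomial_fun_def)
  have "polynomial_fun N (\<lambda>x. \<Sum>m\<in>Poly_Mapping.keys P. \<Sum>n\<in>Poly_Mapping.keys Q.
      (Poly_Mapping.lookup P m * Poly_Mapping.lookup Q n) * monomial (m + n) (\<lambda>u. entry u x))"
  proof (intro polynomial_fun_sum polynomial_fun_monomial)
    fix m n assume "m \<in> Poly_Mapping.keys P" "n \<in> Poly_Mapping.keys Q"
    then show "Poly_Mapping.keys (m + n) \<subseteq> coords N"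
      using P(1) Q(1) Poly_Mapping.keys_add[of m n] unfolding cpoly_vars_def by blast
  qed
  moreover have "(\<Sum>m\<in>Poly_Mapping.keys P. \<Sum>n\<in>Poly_Mapping.keys Q.
      (Poly_Mapping.lookup P m * Poly_Mapping.lookup Q n) * monomial (m + n) (\<lambda>u. entry u x))
      = f x * g x" for x
    unfolding P(2)[symmetric] Q(2)[symmetric]
    by (simp add: cpoly_eval_superset[OF finite_keys order_refl] sum_product monomial_add ac_simps)
  ultimately show ?thesis
    by simp
qed

lemma rational_on_iff:
  "rational_on N D F \<longleftrightarrow>
     (\<exists>p q. polynomial_fun N p \<and> polynomial_fun N q \<and> (\<forall>x\<in>D. q x \<noteq> 0 \<and> F x = p x / q x))"
  (is "_ \<longleftrightarrow> ?R")
proof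
  assume "rational_on N D F"
  then obtain P Q where "cpoly_vars P \<subseteq> coords N" "cpoly_vars Q \<subseteq> coords N"
    "\<forall>x\<in>D. cpoly_eval Q (\<lambda>u. entry u x) \<noteq> 0 \<and>
       F x = cpoly_eval P (\<lambda>u. entry u x) / cpoly_eval Q (\<lambda>u. entry u x)"
    unfolding rational_on_def by blast
  then show ?R
    unfolding polynomial_fun_def
    by (intro exI[of _ "\<lambda>x. cpoly_eval P (\<lambda>u. entry u x)"]
        exI[of _ "\<lambda>x. cpoly_eval Q (\<lambda>u. entry u x)"]) blast
next
  assume ?R
  then obtain p q P Q where *: "\<forall>x\<in>D. q x \<noteq> 0 \<and> F x = p x / q x"
    "cpoly_vars P \<subseteq> coords N" "\<And>x. cpoly_eval P (\<lambda>u. entry u x) = p x"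
    "cpoly_vars Q \<subseteq> coords N" "\<And>x. cpoly_eval Q (\<lambda>u. entry u x) = q x"
    unfolding polynomial_fun_def by metis
  then show "rational_on N D F"
    unfolding rational_on_def by (intro exI[of _ P] exI[of _ Q]) simp
qed

lemma rational_on_polynomial:
  assumes "polynomial_fun N f"
  shows "rational_on N D f"
  unfolding rational_on_iff using assms polynomial_fun_const[of N 1]
  by (intro exI[of _ f] exI[of _ "\<lambda>_. 1"]) simp

lemmas rational_on_const = rational_on_polynomial[OF polynomial_fun_const]
lemmas rational_on_entry = rational_on_polynomial[OF polynomial_fun_entry]

lemma rational_on_cong:
  assumes "rational_on N D f" "\<And>x. x \<in> E \<Longrightarrow> x \<in> D \<and> g x = f x"
  shows "rational_on N E g"
  using assms unfolding rational_on_def by metis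

lemma rational_on_add:
  assumes "rational_on N D f" "rational_on N D g"
  shows "rational_on N D (\<lambda>x. f x + g x)"
proof -
  obtain p q r s where "polynomial_fun N p" "polynomial_fun N q" "polynomial_fun N r" "polynomial_fun N s"
    "\<forall>x\<in>D. q x \<noteq> 0 \<and> f x = p x / q x" "\<forall>x\<in>D. s x \<noteq> 0 \<and> g x = r x / s x"
    using assms unfolding rational_on_iff by blast
  then show ?thesis
    unfolding rational_on_iff
    by (intro exI[of _ "\<lambda>x. p x * s x + r x * q x"] exI[of _ "\<lambda>x. q x * s x"])
      (auto intro!: polynomial_fun_mult polynomial_fun_add simp: add_frac_eq)
qed

lemma rational_on_mult:
  assumes "rational_on N D f" "rational_on N D g"
  shows "rational_on N D (\<lambda>x. f x * g x)"
proof -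
  obtain p q r s where "polynomial_fun N p" "polynomial_fun N q" "polynomial_fun N r" "polynomial_fun N s"
    "\<forall>x\<in>D. q x \<noteq> 0 \<and> f x = p x / q x" "\<forall>x\<in>D. s x \<noteq> 0 \<and> g x = r x / s x"
    using assms unfolding rational_on_iff by blast
  then show ?thesis
    unfolding rational_on_iff
    by (intro exI[of _ "\<lambda>x. p x * r x"] exI[of _ "\<lambda>x. q x * s x"])
      (auto intro!: polynomial_fun_mult)
qed

lemma rational_on_inverse:
  assumes "rational_on N D f" "\<And>x. x \<in> D \<Longrightarrow> f x \<noteq> 0"
  shows "rational_on N D (\<lambda>x. inverse (f x))"
proof -
  obtain p q where "polynomial_fun N p" "polynomial_fun N q" "\<forall>x\<in>D. q x \<noteq> 0 \<and> f x = p x / q x"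
    using assms unfolding rational_on_iff by blast
  then show ?thesis
    unfolding rational_on_iff using assms(2) by (intro exI[of _ q] exI[of _ p]) fastforce
qed

lemma rational_on_sum:
  assumes "\<And>i. i \<in> I \<Longrightarrow> rational_on N D (f i)"
  shows "rational_on N D (\<lambda>x. \<Sum>i\<in>I. f i x)"
  using assms
  by (induction I rule: infinite_finite_induct) (auto intro: rational_on_const rational_on_add)

lemma rational_on_prod:
  assumes "\<And>i. i \<in> I \<Longrightarrow> rational_on N D (f i)"
  shows "rational_on N D (\<lambda>x. \<Prod>i\<in>I. f i x)"
  using assms
  by (induction I rule: infinite_finite_induct) (auto intro: rational_on_const rational_on_mult)

lemma rational_on_det:
  assumes "\<And>i j. i < n \<Longrightarrow> j < n \<Longrightarrow> rational_on N D (F i j)"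
  shows "rational_on N D (\<lambda>x. det (mat n n (\<lambda>(i, j). F i j x)))"
  unfolding det_mat_leibniz
proof (intro rational_on_sum rational_on_mult rational_on_const rational_on_prod)
  fix p i assume "p \<in> {p. p permutes {0..<n}}" "i \<in> {0..<n}"
  then show "rational_on N D (F i (p i))"
    using assms permutes_in_image[of p "{0..<n}" i] by simp
qed

lemma has_bracket_polynomial:
  assumes x: "x \<in> points N" and w: "w \<in> coords N" and f: "polynomial_fun N f"
  shows "\<exists>d. has_bracket N x w f d"
proof -
  obtain P where P: "cpoly_vars P \<subseteq> coords N" "\<And>x. f x = cpoly_eval P (\<lambda>u. entry u x)"
    using f unfolding polynomial_fun_def by metis
  \<comment> \<open>Powers are written as products of equal factors, so the rule for finite products
    covers them.\<close>
  have *: "has_bracket N x w (\<lambda>x. \<Prod>v\<in>Poly_Mapping.keys m. \<Prod>k<Poly_Mapping.lookup m v. entry v x)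
      (\<Sum>v\<in>Poly_Mapping.keys m. (\<Sum>k<Poly_Mapping.lookup m v. coord_bracket N v w x *
         (\<Prod>k\<in>{..<Poly_Mapping.lookup m v} - {k}. entry v x)) *
           (\<Prod>v\<in>Poly_Mapping.keys m - {v}. \<Prod>k<Poly_Mapping.lookup m v. entry v x))"
    if "m \<in> Poly_Mapping.keys P" for m
    using that P(1)
    by (intro has_bracket_prod has_bracket_entry x w) (auto simp: cpoly_vars_def)
  have "has_bracket N x w (\<lambda>x. \<Sum>m\<in>Poly_Mapping.keys P. Poly_Mapping.lookup P m *
        (\<Prod>v\<in>Poly_Mapping.keys m. \<Prod>k<Poly_Mapping.lookup m v. entry v x)) (\<Sum>m\<in>Poly_Mapping.keys P.
          Poly_Mapping.lookup P m * d m)"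
    if "\<And>m. m \<in> Poly_Mapping.keys P \<Longrightarrow> has_bracket N x w
      (\<lambda>x. \<Prod>v\<in>Poly_Mapping.keys m. \<Prod>k<Poly_Mapping.lookup m v. entry v x) (d m)" for d
    using that by (intro has_bracket_sum has_bracket_cmult x w) auto
  from this[OF *] show ?thesis
    unfolding P(2) cpoly_eval_def by auto
qed

text \<open>Only existence is claimed. For the entries of S the value is then forced by a linear
  system.\<close>

lemma has_bracket_rational:
  assumes x: "x \<in> points N" and w: "w \<in> coords N" and f: "rational_on N D f"
    and D: "x \<in> D" "\<And>u. u \<in> coords N \<Longrightarrow> eventually (\<lambda>t. shift N u t x \<in> D) (nhds 0)"
  shows "\<exists>d. has_bracket N x w f d"
proof -
  obtain p q where pq: "polynomial_fun N p" "polynomial_fun N q"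
      "\<And>x. x \<in> D \<Longrightarrow> q x \<noteq> 0 \<and> f x = p x * inverse (q x)"
    using f unfolding rational_on_iff divide_inverse by blast
  obtain d where d: "has_bracket N x w (\<lambda>y. p y * inverse (q y)) d"
    using has_bracket_polynomial[OF x w pq(1)] has_bracket_polynomial[OF x w pq(2)]
      has_bracket_mult[OF x w] has_bracket_inverse[OF x w] pq(3)[OF D(1)] by meson
  have "has_bracket N x w f d"
  proof (rule has_bracket_eventually_cong[OF d])
    fix u assume u: "u \<in> coords N"
    show "eventually (\<lambda>t. p (shift N u t x) * inverse (q (shift N u t x)) = f (shift N u t x)) (nhds 0)"
    proof (rule eventually_mono[OF D(2)[OF u]])
      fix t assume "shift N u t x \<in> D"
      from pq(3)[OF this] show "p (shift N u t x) * inverse (q (shift N u t x)) = f (shift N u t x)"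
        by simp
    qed
  qed
  then show ?thesis ..
qed

subsection \<open>Log-canonical brackets of the minors\<close>

lemma cofactor_row_sum:
  fixes M :: "'a::comm_ring_1 mat"
  assumes "M \<in> carrier_mat n n" "i < n" "k < n"
  shows "(\<Sum>j<n. cofactor M i j * M $$ (k, j)) = (if i = k then det M else 0)"
proof -
  have "(M * adj_mat M) $$ (k, i) = (\<Sum>j<n. cofactor M i j * M $$ (k, j))"
    using assms
    by (auto simp: adj_mat_def scalar_prod_def atLeast0LessThan ac_simps intro!: sum.cong)
  then show ?thesis
    using adj_mat(2)[OF assms(1)] assms by auto
qed

lemma cofactor_col_sum:
  fixes M :: "'a::comm_ring_1 mat"
  assumes "M \<in> carrier_mat n n" "j < n" "l < n"
  shows "(\<Sum>i<n. cofactor M i j * M $$ (i, l)) = (if j = l then det M else 0)"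
proof -
  have "(adj_mat M * M) $$ (j, l) = (\<Sum>i<n. cofactor M i j * M $$ (i, l))"
    using assms
    by (auto simp: adj_mat_def scalar_prod_def atLeast0LessThan ac_simps intro!: sum.cong)
  then show ?thesis
    using adj_mat(3)[OF assms(1)] assms by auto
qed

text \<open>Summing over j pairs the cofactors of row i with row k of the same matrix, which gives
  det M for i = k and 0 otherwise; only \<open>g k\<close> remains.\<close>

lemma cofactor_contract_row:
  fixes M :: "'a::comm_ring_1 mat"
  assumes M: "M \<in> carrier_mat n n" and "k < n" and R: "\<And>j. j < n \<Longrightarrow> R j = M $$ (k, j)"
  shows "(\<Sum>i<n. \<Sum>j<n. cofactor M i j * (g i * R j)) = g k * det M"
proof -
  have "(\<Sum>i<n. \<Sum>j<n. cofactor M i j * (g i * R j))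
      = (\<Sum>i<n. g i * (\<Sum>j<n. cofactor M i j * M $$ (k, j)))"
    by (auto simp: sum_distrib_left R ac_simps intro!: sum.cong)
  also have "\<dots> = (\<Sum>i<n. g i * (if i = k then det M else 0))"
    using assms by (intro sum.cong refl) (simp add: cofactor_row_sum)
  finally show ?thesis
    using \<open>k < n\<close> by (simp add: if_distrib[of "\<lambda>x. _ * x"] cong: if_cong)
qed

lemma cofactor_contract_col:
  fixes M :: "'a::comm_ring_1 mat"
  assumes M: "M \<in> carrier_mat n n" and "l < n" and C: "\<And>i. i < n \<Longrightarrow> C i = M $$ (i, l)"
  shows "(\<Sum>i<n. \<Sum>j<n. cofactor M i j * (g j * C i)) = g l * det M"
proof -
  have "(\<Sum>i<n. \<Sum>j<n. cofactor M i j * (g j * C i))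
      = (\<Sum>j<n. \<Sum>i<n. cofactor M i j * (g j * C i))"
    by (rule sum.swap)
  also have "\<dots> = (\<Sum>j<n. g j * (\<Sum>i<n. cofactor M i j * M $$ (i, l)))"
    by (auto simp: sum_distrib_left C ac_simps intro!: sum.cong)
  also have "\<dots> = (\<Sum>j<n. g j * (if j = l then det M else 0))"
    using assms by (intro sum.cong refl) (simp add: cofactor_col_sum)
  finally show ?thesis
    using \<open>l < n\<close> by (simp add: if_distrib[of "\<lambda>x. _ * x"] cong: if_cong)
qed

text \<open>The factor \<open>theta\<close> vanishes when the contracted row (column) lies outside the minor.\<close>

lemma theta_contract_row:
  assumes "M \<in> carrier_mat n n" and "\<And>j. k < n \<Longrightarrow> j < n \<Longrightarrow> R j = M $$ (k, j)"
  shows "(\<Sum>i<n. \<Sum>j<n. cofactor M i j * (theta i k * g i * R j)) = (if k < n then g k * det M else 0)"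
proof (cases "k < n")
  case True
  then show ?thesis
    using cofactor_contract_row[of M n k R "\<lambda>i. theta i k * g i"] assms by simp
qed (auto intro!: sum.neutral)

lemma theta_contract_col:
  assumes "M \<in> carrier_mat n n" and "l < m + n"
    and "\<And>i. m \<le> l \<Longrightarrow> i < n \<Longrightarrow> C i = M $$ (i, l - m)"
  shows "(\<Sum>i<n. \<Sum>j<n. cofactor M i j * (theta l (m + j) * g (m + j) * C i))
    = (if m \<le> l then g l * det M else 0)"
proof (cases "m \<le> l")
  case True
  then show ?thesis
    using cofactor_contract_col[of M n "l - m" C "\<lambda>j. theta l (m + j) * g (m + j)"] assms by simp
qed (auto intro!: sum.neutral)

section \<open>Weights, and the pencil z A + v A^T\<close>

fun sym_weight :: "coord \<Rightarrow> complex" where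
  "sym_weight (EntA k l) = 0"
| "sym_weight (EntB k l) = 2"

text \<open>\<open>N \<le> q + l\<close> says that l is among the last q indices, the columns of the
  corner. Both indices of an entry of A are tested against columns, since its bracket with B leaves
  the row index of B alone.\<close>

fun minor_B_weight :: "nat \<Rightarrow> nat \<Rightarrow> coord \<Rightarrow> complex" where
  "minor_B_weight N q (EntA k l) = - of_bool (N \<le> q + k) - of_bool (N \<le> q + l)"
| "minor_B_weight N q (EntB k l) = of_bool (k < q) - of_bool (N \<le> q + l)"

fun minor_S_weight :: "nat \<Rightarrow> coord \<Rightarrow> complex" where
  "minor_S_weight q (EntA k l) = of_bool (k < q) + of_bool (l < q)"
| "minor_S_weight q (EntB k l) = of_bool (k < q) + of_bool (l < q)"

text \<open>Homogeneous in (z, v): (1, 0) gives A, (w, 1) the polynomial in w, and (z, 1/z) the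
  matrix of the \<lambda>-expansion.\<close>

definition sym_mat :: "nat \<Rightarrow> complex \<Rightarrow> complex \<Rightarrow> complex mat \<Rightarrow> complex mat" where
  "sym_mat N z v A = mat N N (\<lambda>(i, j). z * A $$ (i, j) + v * A $$ (j, i))"

lemma entry_simps: "entry (EntA i j) y = fst y $$ (i, j)" "entry (EntB i j) y = snd y $$ (i, j)"
  by (cases y; simp)+

lemma has_weight_det:
  assumes x: "x \<in> points N" and w: "w \<in> coords N"
    and d: "\<And>i j. i < n \<Longrightarrow> j < n \<Longrightarrow> has_bracket N x w (F i j) (d i j)"
    and M: "M = mat n n (\<lambda>(i, j). F i j x)"
    and "(\<Sum>i<n. \<Sum>j<n. cofactor M i j * d i j) = c * det M * entry w x"
  shows "has_weight N x w (\<lambda>y. det (mat n n (\<lambda>(i, j). F i j y))) c"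
  using has_bracket_det[OF x w, of n F d, OF d] assms(5) unfolding has_weight_def M by simp

text \<open>The bracket of an entry of the pencil M is a sum of terms, each consisting of a row or
  column of M times a factor in the other index. Contraction leaves the diagonal values of
  \<open>theta\<close>: 1 + 1 - 1 - 1 = 0 against an entry of A, and 1 + 1 = 2 against an entry of
  B.\<close>

lemma has_weight_sym:
  assumes x: "x \<in> points N" and w: "w \<in> coords N"
  shows "has_weight N x w (\<lambda>y. det (sym_mat N z v (fst y))) (sym_weight w)"
proof -
  obtain A B where AB: "x = (A, B)"
    by (cases x)
  define M where "M = mat N N (\<lambda>(i, j). z * entry (EntA i j) x + v * entry (EntA j i) x)"
  define d where "d i j = z * coord_bracket N (EntA i j) w x + v * coord_bracket N (EntA j i) w x" for i j
  have Mc: "M \<in> carrier_mat N N"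
    by (simp add: M_def)
  have Me: "M $$ (i, j) = z * A $$ (i, j) + v * A $$ (j, i)" if "i < N" "j < N" for i j
    using that by (simp add: M_def AB)
  have d: "has_bracket N x w (\<lambda>y. z * entry (EntA i j) y + v * entry (EntA j i) y) (d i j)"
    if "i < N" "j < N" for i j
    unfolding d_def using that
    by (intro has_bracket_add has_bracket_cmult has_bracket_entry x w) auto
  have "(\<Sum>i<N. \<Sum>j<N. cofactor M i j * d i j) = sym_weight w * det M * entry w x"
    using w
  proof (cases rule: coords_cases)
    case (1 k l)
    have "d i j = (theta i k * A $$ (i, l)) * M $$ (k, j) + (theta j k * A $$ (j, l)) * M $$ (i, k)
       + (- theta l j * A $$ (k, j)) * M $$ (i, l) + (- theta l i * A $$ (k, i)) * M $$ (l, j)"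
      if "i < N" "j < N" for i j
      unfolding d_def 1 AB using that 1 by (simp add: coord_bracket_AA Me algebra_simps del: coord_bracket.simps)
    then have "(\<Sum>i<N. \<Sum>j<N. cofactor M i j * d i j) =
         (\<Sum>i<N. \<Sum>j<N. cofactor M i j * ((theta i k * A $$ (i, l)) * M $$ (k, j))) +
         (\<Sum>i<N. \<Sum>j<N. cofactor M i j * ((theta j k * A $$ (j, l)) * M $$ (i, k))) +
         (\<Sum>i<N. \<Sum>j<N. cofactor M i j * ((- theta l j * A $$ (k, j)) * M $$ (i, l))) +
         (\<Sum>i<N. \<Sum>j<N. cofactor M i j * ((- theta l i * A $$ (k, i)) * M $$ (l, j)))"
      by (simp only: sum.distrib[symmetric] distrib_left[symmetric]) simp
    then show ?thesis
      unfolding cofactor_contract_row[OF Mc \<open>k < N\<close> refl] cofactor_contract_col[OF Mc \<open>k < N\<close> refl]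
        cofactor_contract_row[OF Mc \<open>l < N\<close> refl] cofactor_contract_col[OF Mc \<open>l < N\<close> refl]
      by (simp add: 1)
  next
    case (2 k l)
    have "d i j = (theta i l * B $$ (k, i)) * M $$ (l, j) + (theta j l * B $$ (k, j)) * M $$ (i, l)"
      if "i < N" "j < N" for i j
      unfolding d_def 2 AB using that 2 by (simp add: coord_bracket_AB Me algebra_simps del: coord_bracket.simps)
    then have "(\<Sum>i<N. \<Sum>j<N. cofactor M i j * d i j) =
         (\<Sum>i<N. \<Sum>j<N. cofactor M i j * ((theta i l * B $$ (k, i)) * M $$ (l, j))) +
         (\<Sum>i<N. \<Sum>j<N. cofactor M i j * ((theta j l * B $$ (k, j)) * M $$ (i, l)))"
      by (simp only: sum.distrib[symmetric] distrib_left[symmetric]) simp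
    then show ?thesis
      unfolding cofactor_contract_row[OF Mc \<open>l < N\<close> refl] cofactor_contract_col[OF Mc \<open>l < N\<close> refl]
      by (simp add: 2 AB)
  qed
  from has_weight_det[OF x w d M_def this] show ?thesis
    by (simp add: sym_mat_def entry_simps)
qed

section \<open>Upper-right minors of B\<close>

definition corner_B :: "nat \<Rightarrow> nat \<Rightarrow> complex mat \<Rightarrow> complex mat" where
  "corner_B N q B = mat q q (\<lambda>(i, j). B $$ (i, N - q + j))"

text \<open>Rows enter through \<open>theta i k\<close>, which vanishes for i < q \<le> k, and
  columns through \<open>theta l (N - q + j)\<close>, which vanishes for l < N - q. Hence the rows
  have to be initial and the columns final: the upper-right corner.\<close>

lemma has_weight_corner_B:
  assumes x: "x \<in> points N" and w: "w \<in> coords N" and q: "q \<le> N"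
  shows "has_weight N x w (\<lambda>y. det (corner_B N q (snd y))) (minor_B_weight N q w)"
proof -
  obtain A B where AB: "x = (A, B)"
    by (cases x)
  define M where "M = mat q q (\<lambda>(i, j). entry (EntB i (N - q + j)) x)"
  define d where "d i j = coord_bracket N (EntB i (N - q + j)) w x" for i j
  have Mc: "M \<in> carrier_mat q q"
    by (simp add: M_def)
  have Me: "M $$ (i, j) = B $$ (i, N - q + j)" if "i < q" "j < q" for i j
    using that by (simp add: M_def AB)
  have d: "has_bracket N x w (\<lambda>y. entry (EntB i (N - q + j)) y) (d i j)"
    if "i < q" "j < q" for i j
    unfolding d_def using that q by (intro has_bracket_entry x w) auto
  have col: "(\<Sum>i<q. \<Sum>j<q. cofactor M i j * (theta l (N - q + j) * g (N - q + j) * B $$ (i, l)))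
      = (if N - q \<le> l then g l * det M else 0)" if "l < N" for l g
    using that q by (intro theta_contract_col Mc) (auto simp: Me)
  have row: "(\<Sum>i<q. \<Sum>j<q. cofactor M i j * (theta i k * g i * B $$ (k, N - q + j)))
      = (if k < q then g k * det M else 0)" for k g
    by (intro theta_contract_row Mc) (auto simp: Me)
  have "(\<Sum>i<q. \<Sum>j<q. cofactor M i j * d i j) = minor_B_weight N q w * det M * entry w x"
    using w
  proof (cases rule: coords_cases)
    case (1 k l)
    have "d i j = theta k (N - q + j) * (- A $$ (N - q + j, l)) * B $$ (i, k)
        + theta l (N - q + j) * (- A $$ (k, N - q + j)) * B $$ (i, l)"
      if "i < q" "j < q" for i j
      unfolding d_def 1 AB using that 1 q by (simp add: coord_bracket_BA del: coord_bracket.simps)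
    then have "(\<Sum>i<q. \<Sum>j<q. cofactor M i j * d i j) =
         (\<Sum>i<q. \<Sum>j<q. cofactor M i j * (theta k (N - q + j) * (- A $$ (N - q + j, l)) * B $$ (i, k))) +
         (\<Sum>i<q. \<Sum>j<q. cofactor M i j * (theta l (N - q + j) * (- A $$ (k, N - q + j)) * B $$ (i, l)))"
      by (simp only: sum.distrib[symmetric] distrib_left[symmetric]) simp
    then show ?thesis
      unfolding col[OF \<open>k < N\<close>, of "\<lambda>n. - A $$ (n, l)"] col[OF \<open>l < N\<close>, of "\<lambda>n. - A $$ (k, n)"]
      using q by (auto simp: 1 AB)
  next
    case (2 k l)
    have "d i j = theta i k * B $$ (i, l) * B $$ (k, N - q + j)
        + theta l (N - q + j) * (- B $$ (k, N - q + j)) * B $$ (i, l)"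
      if "i < q" "j < q" for i j
      unfolding d_def 2 AB using that 2 q
      by (simp add: coord_bracket_BB algebra_simps del: coord_bracket.simps)
    then have "(\<Sum>i<q. \<Sum>j<q. cofactor M i j * d i j) =
         (\<Sum>i<q. \<Sum>j<q. cofactor M i j * (theta i k * B $$ (i, l) * B $$ (k, N - q + j))) +
         (\<Sum>i<q. \<Sum>j<q. cofactor M i j * (theta l (N - q + j) * (- B $$ (k, N - q + j)) * B $$ (i, l)))"
      by (simp only: sum.distrib[symmetric] distrib_left[symmetric]) simp
    then show ?thesis
      unfolding col[OF \<open>l < N\<close>, of "\<lambda>n. - B $$ (k, n)"] row using q by (auto simp: 2 AB)
  qed
  from has_weight_det[OF x w d M_def this] show ?thesis
    by (simp add: corner_B_def entry_simps)
qed

lemma rational_on_subset: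
  assumes "rational_on N D f" "E \<subseteq> D"
  shows "rational_on N E f"
  using assms rational_on_cong[of N D f E f] by auto

lemma sym_mat_1_0:
  assumes "A \<in> carrier_mat N N"
  shows "sym_mat N 1 0 A = A"
  using assms by (auto simp: sym_mat_def)

lemma corner_B_full:
  assumes "B \<in> carrier_mat N N"
  shows "corner_B N N B = B"
  using assms by (auto simp: corner_B_def)

lemma has_weight_cong:
  assumes "has_weight N x w f c" "x \<in> points N" "\<And>y. y \<in> points N \<Longrightarrow> f y = g y"
  shows "has_weight N x w g c"
  using has_bracket_cong[OF assms(1)[unfolded has_weight_def] assms(2), of g] assms(2,3)
  by (simp add: has_weight_def)

lemma has_weight_det_A:
  assumes "x \<in> points N" "w \<in> coords N"
  shows "has_weight N x w (\<lambda>y. det (fst y)) (sym_weight w)"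
  by (rule has_weight_cong[OF has_weight_sym[OF assms, of 1 0] assms(1)])
    (auto simp: points_def sym_mat_1_0)

lemma has_weight_det_B:
  assumes "x \<in> points N" "w \<in> coords N"
  shows "has_weight N x w (\<lambda>y. det (snd y)) (minor_B_weight N N w)"
  by (rule has_weight_cong[OF has_weight_corner_B[OF assms order_refl] assms(1)])
    (auto simp: points_def corner_B_full)

section \<open>Stability of nondegeneracy along coordinate lines\<close>

lemma nondegenerate_points: "x \<in> nondegenerate N \<Longrightarrow> x \<in> points N"
  by (auto simp: nondegenerate_def points_def)

text \<open>Openness is needed only along coordinate lines, where differentiability already gives
  continuity; no topology on matrices enters.\<close>

lemma has_bracket_eventually_nonzero:
  assumes "has_bracket N x w f d" "x \<in> points N" "f x \<noteq> 0" "u \<in> coords N"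
  shows "eventually (\<lambda>t. f (shift N u t x) \<noteq> 0) (nhds 0)"
proof -
  have "isCont (\<lambda>t. f (shift N u t x)) 0"
    using assms unfolding has_bracket_def by (meson DERIV_isCont)
  then have "filterlim (\<lambda>t. f (shift N u t x)) (nhds (f (shift N u 0 x))) (nhds 0)"
    unfolding isCont_def using tendsto_at_iff_tendsto_nhds[of "\<lambda>t. f (shift N u t x)" 0] by simp
  then have "filterlim (\<lambda>t. f (shift N u t x)) (nhds (f x)) (nhds 0)"
    using assms(2) by (simp add: shift_0)
  then show ?thesis
    using assms(3) by (rule tendsto_imp_eventually_ne)
qed

lemma eventually_nondegenerate:
  assumes x: "x \<in> nondegenerate N" and u: "u \<in> coords N"
  shows "eventually (\<lambda>t. shift N u t x \<in> nondegenerate N) (nhds 0)"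
proof -
  note xp = nondegenerate_points[OF x]
  have nz: "det (fst x) \<noteq> 0" "det (snd x) \<noteq> 0"
    using x by (auto simp: nondegenerate_def)
  have "eventually (\<lambda>t. det (fst (shift N u t x)) \<noteq> 0) (nhds 0)"
    "eventually (\<lambda>t. det (snd (shift N u t x)) \<noteq> 0) (nhds 0)"
    by (rule has_bracket_eventually_nonzero[OF _ xp _ u, where f = "\<lambda>y. det (fst y)"]
        has_bracket_eventually_nonzero[OF _ xp _ u, where f = "\<lambda>y. det (snd y)"],
        rule has_weight_det_A[OF xp u, unfolded has_weight_def]
        has_weight_det_B[OF xp u, unfolded has_weight_def], rule nz)+
  then show ?thesis
  proof eventually_elim
    case (elim t)
    then show ?case
      using shift_points[OF xp, of u t] by (auto simp: nondegenerate_def points_def)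
  qed
qed

lemma has_weight_cong_nondegenerate:
  assumes "has_weight N x w f c" "x \<in> nondegenerate N" "\<And>y. y \<in> nondegenerate N \<Longrightarrow> f y = g y"
  shows "has_weight N x w g c"
proof -
  have "has_bracket N x w g (c * f x * entry w x)"
  proof (rule has_bracket_eventually_cong[OF assms(1)[unfolded has_weight_def]])
    fix u assume "u \<in> coords N"
    from eventually_nondegenerate[OF assms(2) this]
    show "eventually (\<lambda>t. f (shift N u t x) = g (shift N u t x)) (nhds 0)"
      by (rule eventually_mono) (rule assms(3))
  qed
  then show ?thesis
    using assms(2,3) by (simp add: has_weight_def)
qed

section \<open>The matrix S and its leading minors\<close>

lemma mat_inverse_nondegenerate:
  fixes B :: "'a::field mat"
  assumes B: "B \<in> carrier_mat N N" and "det B \<noteq> 0"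
  shows "the (mat_inverse B) \<in> carrier_mat N N" "the (mat_inverse B) * B = 1\<^sub>m N"
proof -
  obtain C where "mat_inverse B = Some C"
    using mat_inverse(1)[OF B, where b = "()"] det_non_zero_imp_unit[OF assms, where b = "()"]
    by (cases "mat_inverse B") auto
  then show "the (mat_inverse B) \<in> carrier_mat N N" "the (mat_inverse B) * B = 1\<^sub>m N"
    using mat_inverse(2)[OF B] by auto
qed

context
  fixes N :: nat and A B :: "complex mat"
  assumes AB: "(A, B) \<in> nondegenerate N"
begin

lemma nondegenerate_pair: "A \<in> carrier_mat N N" "B \<in> carrier_mat N N" "det A \<noteq> 0" "det B \<noteq> 0"
  using AB by (auto simp: nondegenerate_def)

lemma S_mat_carrier: "S_mat A B \<in> carrier_mat N N"
  using nondegenerate_pair mat_inverse_nondegenerate[of B N] by (auto simp: S_mat_def)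

lemma S_mat_mult_B: "S_mat A B * B = transpose_mat A"
proof -
  have "S_mat A B * B = transpose_mat A * (the (mat_inverse B) * B)"
    unfolding S_mat_def using nondegenerate_pair mat_inverse_nondegenerate[of B N]
    by (intro assoc_mult_mat[of _ N N _ N _ N]) auto
  then show ?thesis
    using nondegenerate_pair mat_inverse_nondegenerate[of B N] by simp
qed

lemma S_mat_sum:
  assumes "i < N" "m < N"
  shows "(\<Sum>j<N. S_mat A B $$ (i, j) * B $$ (j, m)) = A $$ (m, i)"
proof -
  have "(S_mat A B * B) $$ (i, m) = (\<Sum>j<N. S_mat A B $$ (i, j) * B $$ (j, m))"
    using assms nondegenerate_pair S_mat_carrier by (simp add: scalar_prod_def atLeast0LessThan)
  then show ?thesis
    using assms nondegenerate_pair by (simp add: S_mat_mult_B)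
qed

text \<open>Cancels B in e B = f B for row vectors, by contracting with its cofactors. Vectors are
  functions, so that \<open>e\<close> may be a row of brackets as well as a row of S.\<close>

lemma right_mult_B_inj:
  assumes "\<And>m. m < N \<Longrightarrow> (\<Sum>j<N. e j * B $$ (j, m)) = (\<Sum>j<N. f j * B $$ (j, m))" and "n < N"
  shows "e n = f n"
proof -
  have *: "(\<Sum>m<N. cofactor B n m * (\<Sum>j<N. e j * B $$ (j, m))) = e n * det B" for e
  proof -
    have "(\<Sum>m<N. cofactor B n m * (\<Sum>j<N. e j * B $$ (j, m)))
        = (\<Sum>m<N. \<Sum>j<N. e j * (cofactor B n m * B $$ (j, m)))"
      by (simp add: sum_distrib_left ac_simps)
    also have "\<dots> = (\<Sum>j<N. e j * (\<Sum>m<N. cofactor B n m * B $$ (j, m)))"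
      unfolding sum_distrib_left by (rule sum.swap)
    also have "\<dots> = (\<Sum>j<N. e j * (if n = j then det B else 0))"
      using nondegenerate_pair \<open>n < N\<close> by (intro sum.cong refl) (simp add: cofactor_row_sum)
    finally show ?thesis
      using \<open>n < N\<close> by (simp add: if_distrib[of "\<lambda>x. _ * x"] cong: if_cong)
  qed
  have "e n * det B = f n * det B"
    unfolding *[symmetric] using assms(1) by simp
  then show ?thesis
    using nondegenerate_pair by simp
qed

text \<open>Cramer's rule. It shows that the entries of S are rational, hence differentiable; their
  brackets are computed without it.\<close>

lemma S_mat_cofactor:
  assumes "i < N" "j < N"
  shows "S_mat A B $$ (i, j) = (\<Sum>m<N. A $$ (m, i) * (cofactor B j m * inverse (det B)))"
proof (rule right_mult_B_inj[OF _ \<open>j < N\<close>])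
  fix m assume m: "m < N"
  have "(\<Sum>j<N. (\<Sum>n<N. A $$ (n, i) * (cofactor B j n * inverse (det B))) * B $$ (j, m))
      = (\<Sum>n<N. A $$ (n, i) * inverse (det B) * (\<Sum>j<N. cofactor B j n * B $$ (j, m)))"
    unfolding sum_distrib_left sum_distrib_right
    by (subst sum.swap) (simp add: ac_simps)
  also have "\<dots> = (\<Sum>n<N. A $$ (n, i) * inverse (det B) * (if n = m then det B else 0))"
    using nondegenerate_pair m by (intro sum.cong refl) (simp add: cofactor_col_sum)
  also have "\<dots> = A $$ (m, i)"
    using m nondegenerate_pair by (simp add: if_distrib[of "\<lambda>x. _ * x"] cong: if_cong)
  also have "\<dots> = (\<Sum>j<N. S_mat A B $$ (i, j) * B $$ (j, m))"
    using S_mat_sum[OF \<open>i < N\<close> m] ..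
  finally show "(\<Sum>j<N. S_mat A B $$ (i, j) * B $$ (j, m))
      = (\<Sum>j<N. (\<Sum>n<N. A $$ (n, i) * (cofactor B j n * inverse (det B))) * B $$ (j, m))" ..
qed

end

definition S_entry :: "nat \<Rightarrow> nat \<Rightarrow> point \<Rightarrow> complex" where
  "S_entry i j y = S_mat (fst y) (snd y) $$ (i, j)"

lemma rational_on_det_A: "rational_on N (nondegenerate N) (\<lambda>y. det (fst y))"
proof (rule rational_on_cong)
  show "rational_on N (nondegenerate N) (\<lambda>y. det (mat N N (\<lambda>(i, j). entry (EntA i j) y)))"
    by (intro rational_on_det rational_on_entry) auto
  show "y \<in> nondegenerate N \<and> det (fst y) = det (mat N N (\<lambda>(i, j). entry (EntA i j) y))"
    if "y \<in> nondegenerate N" for y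
    using that by (auto simp: entry_simps nondegenerate_def intro!: arg_cong[of _ _ det])
qed

lemma rational_on_det_B: "rational_on N (nondegenerate N) (\<lambda>y. det (snd y))"
proof (rule rational_on_cong)
  show "rational_on N (nondegenerate N) (\<lambda>y. det (mat N N (\<lambda>(i, j). entry (EntB i j) y)))"
    by (intro rational_on_det rational_on_entry) auto
  show "y \<in> nondegenerate N \<and> det (snd y) = det (mat N N (\<lambda>(i, j). entry (EntB i j) y))"
    if "y \<in> nondegenerate N" for y
    using that by (auto simp: entry_simps nondegenerate_def intro!: arg_cong[of _ _ det])
qed

lemma rational_on_cofactor_B:
  assumes "a < N" "b < N"
  shows "rational_on N (nondegenerate N) (\<lambda>y. cofactor (snd y) a b)"
proof (rule rational_on_cong)
  show "rational_on N (nondegenerate N) (\<lambda>y. (- 1) ^ (a + b) * det (mat (N - 1) (N - 1) (\<lambda>(i, j).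
      entry (EntB (if i < a then i else Suc i) (if j < b then j else Suc j)) y)))"
    using assms by (intro rational_on_mult rational_on_const rational_on_det rational_on_entry) auto
  show "y \<in> nondegenerate N \<and> cofactor (snd y) a b = (- 1) ^ (a + b) * det (mat (N - 1) (N - 1) (\<lambda>(i, j).
      entry (EntB (if i < a then i else Suc i) (if j < b then j else Suc j)) y))"
    if "y \<in> nondegenerate N" for y
    using that assms
    by (auto simp: cofactor_def mat_delete_def entry_simps nondegenerate_def)
qed

lemma rational_on_S_entry:
  assumes "i < N" "j < N"
  shows "rational_on N (nondegenerate N) (S_entry i j)"
proof (rule rational_on_cong)
  show "rational_on N (nondegenerate N)
      (\<lambda>y. \<Sum>m<N. entry (EntA m i) y * (cofactor (snd y) j m * inverse (det (snd y))))"
    using assms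
    by (intro rational_on_sum rational_on_mult rational_on_entry rational_on_cofactor_B
        rational_on_inverse rational_on_det_B) (auto simp: nondegenerate_def)
  show "y \<in> nondegenerate N \<and>
      S_entry i j y = (\<Sum>m<N. entry (EntA m i) y * (cofactor (snd y) j m * inverse (det (snd y))))"
    if "y \<in> nondegenerate N" for y
    using that assms S_mat_cofactor[of "fst y" "snd y" N i j] by (simp add: S_entry_def entry_simps)
qed

text \<open>The closed formula claimed for the bracket of S_ij with an entry. An entry B_kl
  contributes an extra term in the single column k, where the sum is (S B)_il weighted by
  \<open>theta k\<close>.\<close>

fun S_bracket :: "nat \<Rightarrow> complex mat \<Rightarrow> complex mat \<Rightarrow> nat \<Rightarrow> nat \<Rightarrow> coord \<Rightarrow> complex" where
  "S_bracket N A B i j (EntA k l) =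
     theta i k * A $$ (i, l) * S_mat A B $$ (k, j) + theta i l * A $$ (k, i) * S_mat A B $$ (l, j)"
| "S_bracket N A B i j (EntB k l) =
     theta i l * B $$ (k, i) * S_mat A B $$ (l, j) +
     (if j = k then \<Sum>a<N. theta k a * S_mat A B $$ (i, a) * B $$ (a, l) else 0)"

text \<open>The Leibniz rule for S B = A^T with the closed formula in place of the bracket of S. The
  sums over j contract by S B = A^T, and the remaining quadratic terms match because
  \<open>theta i j\<close> and \<open>theta j i\<close> add up to 2.\<close>

lemma S_bracket_equation:
  assumes AB: "(A, B) \<in> nondegenerate N" and w: "w \<in> coords N" and im: "i < N" "m < N"
  shows "(\<Sum>j<N. S_bracket N A B i j w * B $$ (j, m)
        + S_mat A B $$ (i, j) * coord_bracket N (EntB j m) w (A, B))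
    = coord_bracket N (EntA m i) w (A, B)"
  using w
proof (cases rule: coords_cases)
  case (1 k l)
  note sums = S_mat_sum[OF AB]
  have "(\<Sum>j<N. S_bracket N A B i j w * B $$ (j, m)
        + S_mat A B $$ (i, j) * coord_bracket N (EntB j m) w (A, B))
      = (\<Sum>j<N. theta i k * A $$ (i, l) * (S_mat A B $$ (k, j) * B $$ (j, m))
         + theta i l * A $$ (k, i) * (S_mat A B $$ (l, j) * B $$ (j, m))
         - theta k m * A $$ (m, l) * (S_mat A B $$ (i, j) * B $$ (j, k))
         - theta l m * A $$ (k, m) * (S_mat A B $$ (i, j) * B $$ (j, l)))"
    using 1 im by (intro sum.cong refl) (simp add: coord_bracket_BA algebra_simps del: coord_bracket.simps)
  also have "\<dots> = theta i k * A $$ (i, l) * A $$ (m, k) + theta i l * A $$ (k, i) * A $$ (m, l)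
         - theta k m * A $$ (m, l) * A $$ (k, i) - theta l m * A $$ (k, m) * A $$ (l, i)"
    using 1 im by (simp add: sum.distrib sum_subtractf sum_distrib_left[symmetric] sums)
  also have "\<dots> = coord_bracket N (EntA m i) w (A, B)"
    using 1 im
    by (simp add: coord_bracket_AA theta_flip[of m k] theta_flip[of l i] algebra_simps
        del: coord_bracket.simps)
  finally show ?thesis .
next
  case (2 k l)
  note sums = S_mat_sum[OF AB]
  \<comment> \<open>The part of (S B)_il weighted by \<open>theta k\<close>. The opposite weighting
    comes from the bracket of B with itself and equals 2 A_li - T, so T cancels.\<close>
  define T where "T = (\<Sum>a<N. theta k a * S_mat A B $$ (i, a) * B $$ (a, l))"
  have T: "(\<Sum>j<N. theta j k * (S_mat A B $$ (i, j) * B $$ (j, l))) = 2 * A $$ (l, i) - T"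
    using 2 im sums[of i l]
    by (subst theta_flip) (simp add: T_def left_diff_distrib sum_subtractf sum_distrib_left[symmetric] mult.assoc)
  have "(\<Sum>j<N. S_bracket N A B i j w * B $$ (j, m)
        + S_mat A B $$ (i, j) * coord_bracket N (EntB j m) w (A, B))
      = (\<Sum>j<N. theta i l * B $$ (k, i) * (S_mat A B $$ (l, j) * B $$ (j, m))
         + (if j = k then T * B $$ (k, m) else 0)
         + B $$ (k, m) * (theta j k * (S_mat A B $$ (i, j) * B $$ (j, l)))
         - theta l m * B $$ (k, m) * (S_mat A B $$ (i, j) * B $$ (j, l)))"
    using 2 im
    by (intro sum.cong refl) (simp add: coord_bracket_BB T_def algebra_simps del: coord_bracket.simps)
  also have "\<dots> = theta i l * B $$ (k, i) * A $$ (m, l) + T * B $$ (k, m)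
         + B $$ (k, m) * (2 * A $$ (l, i) - T) - theta l m * B $$ (k, m) * A $$ (l, i)"
    using 2 im by (simp add: sum.distrib sum_subtractf sum_distrib_left[symmetric] sums T)
  also have "\<dots> = coord_bracket N (EntA m i) w (A, B)"
    using 2 im
    by (simp add: coord_bracket_AB theta_flip[of m l] algebra_simps del: coord_bracket.simps)
  finally show ?thesis .
qed

text \<open>Rationality provides some brackets \<open>d j\<close>. They and the closed formula solve
  the same linear system with matrix B, so they coincide.\<close>

lemma has_bracket_S_entry:
  assumes AB: "(A, B) \<in> nondegenerate N" and w: "w \<in> coords N" and ij: "i < N" "j < N"
  shows "has_bracket N (A, B) w (S_entry i j) (S_bracket N A B i j w)"
proof -
  note x = nondegenerate_points[OF AB]
  have "\<exists>d. has_bracket N (A, B) w (S_entry i j) d" if "j < N" for j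
    by (rule has_bracket_rational[OF x w rational_on_S_entry[OF \<open>i < N\<close> that] AB])
      (rule eventually_nondegenerate[OF AB])
  then obtain d where d: "\<And>j. j < N \<Longrightarrow> has_bracket N (A, B) w (S_entry i j) (d j)"
    by metis
  have "d j = S_bracket N A B i j w"
  proof (rule right_mult_B_inj[OF AB _ \<open>j < N\<close>])
    fix m assume m: "m < N"
    \<comment> \<open>The function is (S B)_im, which equals A_mi near the point, so its bracket is
      obtained twice: by the product rule and as a coordinate bracket.\<close>
    have "has_bracket N (A, B) w (\<lambda>y. \<Sum>j<N. S_entry i j y * entry (EntB j m) y)
        (\<Sum>j<N. d j * entry (EntB j m) (A, B) + S_entry i j (A, B) * coord_bracket N (EntB j m) w (A, B))"
      using m by (intro has_bracket_sum has_bracket_mult has_bracket_entry x w d) auto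
    moreover have "has_bracket N (A, B) w (\<lambda>y. \<Sum>j<N. S_entry i j y * entry (EntB j m) y)
        (coord_bracket N (EntA m i) w (A, B))"
    proof (rule has_bracket_eventually_cong[OF has_bracket_entry[OF x w]])
      show "EntA m i \<in> coords N"
        using m ij by simp
      fix u assume "u \<in> coords N"
      from eventually_nondegenerate[OF AB this]
      show "eventually (\<lambda>t. entry (EntA m i) (shift N u t (A, B)) =
          (\<Sum>j<N. S_entry i j (shift N u t (A, B)) * entry (EntB j m) (shift N u t (A, B)))) (nhds 0)"
      proof eventually_elim
        case (elim t)
        then show ?case
          using S_mat_sum[of "fst (shift N u t (A, B))" "snd (shift N u t (A, B))" N i m] m ij
          by (simp add: entry_simps S_entry_def)
      qed
    qed
    ultimately have "(\<Sum>j<N. d j * B $$ (j, m) + S_mat A B $$ (i, j) * coord_bracket N (EntB j m) w (A, B))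
        = coord_bracket N (EntA m i) w (A, B)"
      using has_bracket_unique by (fastforce simp: S_entry_def)
    from trans[OF this S_bracket_equation[OF AB w \<open>i < N\<close> m, symmetric], unfolded sum.distrib]
    show "(\<Sum>j<N. d j * B $$ (j, m)) = (\<Sum>j<N. S_bracket N A B i j w * B $$ (j, m))"
      by (rule add_right_imp_eq)
  qed
  then show ?thesis
    using d[OF \<open>j < N\<close>] by simp
qed

definition corner_S :: "nat \<Rightarrow> complex mat \<Rightarrow> complex mat \<Rightarrow> complex mat" where
  "corner_S q A B = mat q q (\<lambda>(i, j). S_mat A B $$ (i, j))"

text \<open>An entry A_kl moves row i of S to the rows k and l, and each counts if it is a leading
  row. An entry B_kl moves row i to row l and changes column k; the latter accounts for the term k <
  q.\<close>

lemma has_weight_corner_S: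
  assumes x: "x \<in> nondegenerate N" and w: "w \<in> coords N" and q: "q \<le> N"
  shows "has_weight N x w (\<lambda>y. det (corner_S q (fst y) (snd y))) (minor_S_weight q w)"
proof -
  obtain A B where AB: "x = (A, B)"
    by (cases x)
  note x' = x[unfolded AB]
  define M where "M = mat q q (\<lambda>(i, j). S_entry i j x)"
  define d where "d i j = S_bracket N A B i j w" for i j
  have Mc: "M \<in> carrier_mat q q"
    by (simp add: M_def)
  have Me: "M $$ (i, j) = S_mat A B $$ (i, j)" if "i < q" "j < q" for i j
    using that by (simp add: M_def AB S_entry_def)
  have d: "has_bracket N x w (S_entry i j) (d i j)" if "i < q" "j < q" for i j
    unfolding d_def AB using that q by (intro has_bracket_S_entry x' w) auto
  have row: "(\<Sum>i<q. \<Sum>j<q. cofactor M i j * (theta i k * g i * S_mat A B $$ (k, j)))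
      = (if k < q then g k * det M else 0)" for k g
    by (intro theta_contract_row Mc) (auto simp: Me)
  have "(\<Sum>i<q. \<Sum>j<q. cofactor M i j * d i j) = minor_S_weight q w * det M * entry w x"
    using w
  proof (cases rule: coords_cases)
    case (1 k l)
    then have "(\<Sum>i<q. \<Sum>j<q. cofactor M i j * d i j) =
         (\<Sum>i<q. \<Sum>j<q. cofactor M i j * (theta i k * A $$ (i, l) * S_mat A B $$ (k, j))) +
         (\<Sum>i<q. \<Sum>j<q. cofactor M i j * (theta i l * A $$ (k, i) * S_mat A B $$ (l, j)))"
      by (simp only: sum.distrib[symmetric] distrib_left[symmetric] d_def S_bracket.simps)
    then show ?thesis
      unfolding row by (auto simp: 1 AB)
  next
    case (2 k l)
    \<comment> \<open>\<open>theta k a\<close> restricts the sum to a \<le> k < q, so only columns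
      of the minor occur, and the cofactors of column k annihilate all of them except a = k.\<close>
    have last: "(\<Sum>i<q. \<Sum>j<q. cofactor M i j *
        (if j = k then \<Sum>a<N. theta k a * S_mat A B $$ (i, a) * B $$ (a, l) else 0))
        = (if k < q then B $$ (k, l) * det M else 0)"
    proof (cases "k < q")
      case True
      have "(\<Sum>i<q. \<Sum>j<q. cofactor M i j *
          (if j = k then \<Sum>a<N. theta k a * S_mat A B $$ (i, a) * B $$ (a, l) else 0))
          = (\<Sum>i<q. cofactor M i k * (\<Sum>a<N. theta k a * S_mat A B $$ (i, a) * B $$ (a, l)))"
        using True by (simp add: if_distrib[of "\<lambda>x. _ * x"] cong: if_cong)
      also have "\<dots> = (\<Sum>a<N. theta k a * B $$ (a, l) * (\<Sum>i<q. cofactor M i k * S_mat A B $$ (i, a)))"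
        unfolding sum_distrib_left by (subst sum.swap) (simp add: ac_simps)
      also have "\<dots> = (\<Sum>a<N. if a = k then B $$ (k, l) * det M else 0)"
      proof (intro sum.cong refl)
        fix a
        show "theta k a * B $$ (a, l) * (\<Sum>i<q. cofactor M i k * S_mat A B $$ (i, a))
            = (if a = k then B $$ (k, l) * det M else 0)"
        proof (cases "a < q")
          case a: True
          have "(\<Sum>i<q. cofactor M i k * S_mat A B $$ (i, a)) = (\<Sum>i<q. cofactor M i k * M $$ (i, a))"
            using a by (intro sum.cong) (auto simp: Me)
          then show ?thesis
            using cofactor_col_sum[OF Mc True a] by simp
        qed (use True in auto)
      qed
      finally show ?thesis
        using True q by simp
    qed (auto intro!: sum.neutral)
    have "(\<Sum>i<q. \<Sum>j<q. cofactor M i j * d i j) =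
         (\<Sum>i<q. \<Sum>j<q. cofactor M i j * (theta i l * B $$ (k, i) * S_mat A B $$ (l, j))) +
         (\<Sum>i<q. \<Sum>j<q. cofactor M i j *
            (if j = k then \<Sum>a<N. theta k a * S_mat A B $$ (i, a) * B $$ (a, l) else 0))"
      using 2 by (simp only: sum.distrib[symmetric] distrib_left[symmetric] d_def S_bracket.simps)
    then show ?thesis
      unfolding row last by (auto simp: 2 AB)
  qed
  from has_weight_det[OF nondegenerate_points[OF x] w d M_def this] show ?thesis
    by (simp add: corner_S_def S_entry_def)
qed

section \<open>The functions X_p\<close>

lemma pick_interval:
  assumes "m + j < n"
  shows "pick {m..<n} j = m + j"
proof -
  have "{a \<in> {m..<n}. a < m + j} = {m..<m + j}"
    using assms by auto
  then show ?thesis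
    using pick_card_in_set[of "m + j" "{m..<n}"] assms by simp
qed

lemma submatrix_intervals:
  assumes "M \<in> carrier_mat N N" "m + q \<le> N" "n + q \<le> N"
  shows "submatrix M {m..<m + q} {n..<n + q} = mat q q (\<lambda>(i, j). M $$ (m + i, n + j))"
proof -
  have sets: "{i. i < N \<and> i \<in> {m..<m + q}} = {m..<m + q}"
      "{i. i < N \<and> i \<in> {n..<n + q}} = {n..<n + q}"
    using assms by auto
  have dims: "dim_row M = N" "dim_col M = N"
    using assms by auto
  show ?thesis
    unfolding submatrix_def dims sets card_atLeastLessThan
    by (rule eq_matI) (simp_all add: pick_interval)
qed

lemma minor_S_corner:
  assumes "(A, B) \<in> nondegenerate N" "q \<le> N"
  shows "minor_S q A B = det (corner_S q A B)"
  using submatrix_intervals[OF S_mat_carrier[OF assms(1)], of 0 q 0] assms(2)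
  by (simp add: minor_S_def corner_S_def)

lemma minor_B_corner:
  assumes "B \<in> carrier_mat N N" "q \<le> N"
  shows "minor_B N q B = det (corner_B N q B)"
  using submatrix_intervals[OF assms(1), of 0 q "N - q"] assms(2)
  by (simp add: minor_B_def corner_B_def)

lemma casimir_on_weight_0:
  assumes "rational_on N D F" "D \<subseteq> points N"
    and "\<And>x w. x \<in> D \<Longrightarrow> w \<in> coords N \<Longrightarrow> has_weight N x w F 0"
  shows "casimir_on N D F"
  unfolding casimir_on_def
proof (intro conjI ballI)
  fix x w assume "x \<in> D" "w \<in> coords N"
  then show "bracket N F (entry w) x = 0"
    using assms(2,3) bracket_entry[of N x w F 0] by (auto simp: has_weight_def)
qed fact

text \<open>The shape to which the rules for weights and rationality apply: products and inverses of
  explicit determinants.\<close>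

definition X_alt :: "nat \<Rightarrow> nat \<Rightarrow> point \<Rightarrow> complex" where
  "X_alt N p y = det (corner_S p (fst y) (snd y)) * det (corner_S (N - p) (fst y) (snd y)) *
     inverse (det (corner_B N (N - p) (snd y)) * det (corner_B N p (snd y))) *
     (det (snd y) * det (snd y) * inverse (det (fst y)))"

lemma X_fun_eq:
  assumes "y \<in> nondegenerate N" "p \<le> N"
  shows "X_fun N p y = X_alt N p y"
  using assms
  by (auto simp: X_fun_def X_alt_def minor_S_corner minor_B_corner power2_eq_square divide_inverse
      nondegenerate_def)

text \<open>Sizes p and N - p occur together because the last p indices are the complement of the
  first N - p, which makes the index conditions cancel. Against an entry of A the quotient of minors
  has weight 4, the square of det B has -4 and det A has 0; against an entry of B the quotient has
  2, det B has 0 and 1 / det A has -2.\<close>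

lemma casimir_X_fun:
  assumes p: "p \<in> {1..N div 2}"
  shows "casimir_on N (X_domain N p) (X_fun N p)"
proof (rule casimir_on_weight_0)
  have pN: "p \<le> N" "N - p \<le> N" "p \<le> N - p"
    using p by auto
  have dom: "X_domain N p \<subseteq> nondegenerate N"
    by (auto simp: X_domain_def)
  have nz: "det (fst y) \<noteq> 0 \<and> det (corner_B N (N - p) (snd y)) * det (corner_B N p (snd y)) \<noteq> 0"
    if "y \<in> X_domain N p" for y
    using that pN by (auto simp: X_domain_def nondegenerate_def minor_B_corner)
  show "X_domain N p \<subseteq> points N"
    using dom nondegenerate_points by blast
  have S: "rational_on N (X_domain N p) (\<lambda>y. det (corner_S q (fst y) (snd y)))" if "q \<le> N" for q
    unfolding corner_S_def S_entry_def[symmetric]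
    using that by (intro rational_on_det rational_on_subset[OF rational_on_S_entry dom]) auto
  have B: "rational_on N (X_domain N p) (\<lambda>y. det (corner_B N q (snd y)))" if "q \<le> N" for q
    unfolding corner_B_def entry_simps(2)[symmetric]
    using that by (intro rational_on_det rational_on_entry) auto
  have detA: "rational_on N (X_domain N p) (\<lambda>y. det (fst y))"
    and detB: "rational_on N (X_domain N p) (\<lambda>y. det (snd y))"
    using rational_on_subset[OF rational_on_det_A dom] rational_on_subset[OF rational_on_det_B dom] by simp_all
  have "rational_on N (X_domain N p) (X_alt N p)"
    unfolding X_alt_def[abs_def] using nz pN
    by (intro rational_on_mult rational_on_inverse S B detA detB) auto
  then show "rational_on N (X_domain N p) (X_fun N p)"
    by (rule rational_on_cong) (use dom pN X_fun_eq in blast)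
  fix x w assume x: "x \<in> X_domain N p" and w: "w \<in> coords N"
  have xn: "x \<in> nondegenerate N"
    using x dom by auto
  note xp = nondegenerate_points[OF xn]
  have "has_weight N x w (X_alt N p)
     (minor_S_weight p w + minor_S_weight (N - p) w
      + - (minor_B_weight N (N - p) w + minor_B_weight N p w)
      + (minor_B_weight N N w + minor_B_weight N N w + - sym_weight w))"
    unfolding X_alt_def[abs_def] using nz[OF x] pN
    by (intro has_weight_mult has_weight_inverse has_weight_corner_S has_weight_corner_B
        has_weight_det_A has_weight_det_B xn xp w) auto
  also have "minor_S_weight p w + minor_S_weight (N - p) w
      + - (minor_B_weight N (N - p) w + minor_B_weight N p w)
      + (minor_B_weight N N w + minor_B_weight N N w + - sym_weight w) = 0"
  proof -
    have "N \<le> p + k \<longleftrightarrow> \<not> k < N - p" "N \<le> (N - p) + k \<longleftrightarrow> \<not> k < p" for k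
      using pN by linarith+
    with w show ?thesis
      by (cases rule: coords_cases) (simp_all add: of_bool_not_iff)
  qed
  finally show "has_weight N x w (X_fun N p) 0"
    by (rule has_weight_cong_nondegenerate[OF _ xn]) (use X_fun_eq pN in auto)
qed

subsection \<open>The polynomial \<open>det (w A + A\<^sup>T)\<close>\<close>

definition sym_poly :: "nat \<Rightarrow> complex mat \<Rightarrow> complex poly" where
  "sym_poly N A = det (mat N N (\<lambda>(i, j). [:A $$ (j, i), A $$ (i, j):]))"

text \<open>The factor 2 is due to the two coinciding powers of \<open>\<lambda>\<close> in the term \<open>p = N / 2\<close>.\<close>

definition Y_fun :: "nat \<Rightarrow> nat \<Rightarrow> complex mat \<Rightarrow> complex" where
  "Y_fun N p A = coeff (sym_poly N A) p / ((if 2 * p = N then 2 else 1) * det A)"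

lemma poly_sym_poly: "poly (sym_poly N A) w = det (sym_mat N w 1 A)"
  unfolding sym_poly_def sym_mat_def det_mat_leibniz
  by (simp add: poly_sum poly_prod sign_def ac_simps)

lemma degree_sym_poly: "degree (sym_poly N A) \<le> N"
  using degree_det_le[of N "mat N N (\<lambda>(i, j). [:A $$ (j, i), A $$ (i, j):])" 1]
  by (simp add: sym_poly_def)

lemma det_sym_mat_scale: "det (sym_mat N (c * z) (c * v) A) = c ^ N * det (sym_mat N z v A)"
proof -
  have "sym_mat N (c * z) (c * v) A = c \<cdot>\<^sub>m sym_mat N z v A"
    by (auto simp: sym_mat_def algebra_simps)
  then show ?thesis
    by (simp add: sym_mat_def)
qed

lemma det_sym_mat_swap: "det (sym_mat N z v A) = det (sym_mat N v z A)"
proof -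
  have "sym_mat N v z A = transpose_mat (sym_mat N z v A)"
    by (auto simp: sym_mat_def algebra_simps)
  then show ?thesis
    by (simp add: det_transpose[of _ N] sym_mat_def)
qed

lemma det_sym_mat_eq_poly:
  assumes "v \<noteq> 0"
  shows "det (sym_mat N z v A) = v ^ N * poly (sym_poly N A) (z / v)"
  using det_sym_mat_scale[of N v "z / v" 1 A] assms by (simp add: poly_sym_poly)

lemma poly_sym_poly_reciprocal:
  assumes "w \<noteq> 0"
  shows "poly (sym_poly N A) w = w ^ N * poly (sym_poly N A) (1 / w)"
  using det_sym_mat_eq_poly[of w N 1 A] assms by (simp add: poly_sym_poly det_sym_mat_swap[of N w 1])

lemma poly_eqI_nonzero:
  fixes p q :: "complex poly"
  assumes "\<And>w. w \<noteq> 0 \<Longrightarrow> poly p w = poly q w"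
  shows "p = q"
proof (rule ccontr)
  assume "p \<noteq> q"
  then have "finite {w. poly (p - q) w = 0}"
    by (intro poly_roots_finite) simp
  moreover have "UNIV - {0} \<subseteq> {w. poly (p - q) w = 0}"
    using assms by auto
  ultimately have "finite (UNIV - {0 :: complex})"
    using finite_subset by blast
  then show False
    by (simp add: infinite_UNIV_char_0)
qed

lemma poly_sum_upto:
  fixes p :: "'a::comm_semiring_1 poly"
  assumes "degree p \<le> n"
  shows "poly p x = (\<Sum>i\<le>n. coeff p i * x ^ i)"
  unfolding poly_altdef using assms
  by (intro sum.mono_neutral_left) (auto simp: coeff_eq_0)

text \<open>Transposition exchanges A and A^T, so the polynomial equals its reversal
  \<open>r\<close> at every w \<noteq> 0, and therefore as a polynomial.\<close>

lemma coeff_sym_poly_palindrome: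
  assumes "k \<le> N"
  shows "coeff (sym_poly N A) (N - k) = coeff (sym_poly N A) k"
proof -
  let ?q = "sym_poly N A"
  define r where "r = (\<Sum>k\<le>N. monom (coeff ?q k) (N - k))"
  have "poly ?q w = poly r w" if w: "w \<noteq> 0" for w
  proof -
    have "poly ?q w = w ^ N * (\<Sum>k\<le>N. coeff ?q k * (1 / w) ^ k)"
      unfolding poly_sym_poly_reciprocal[OF w] using degree_sym_poly by (simp add: poly_sum_upto)
    also have "\<dots> = poly r w"
      unfolding r_def poly_sum sum_distrib_left using w
      by (intro sum.cong) (auto simp: poly_monom power_diff field_simps)
    finally show ?thesis .
  qed
  then have "?q = r"
    by (rule poly_eqI_nonzero)
  then have "coeff ?q (N - k) = coeff r (N - k)"
    by (rule arg_cong)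
  also have "\<dots> = (\<Sum>j\<le>N. if N - j = N - k then coeff ?q j else 0)"
    by (simp add: r_def coeff_sum)
  also have "\<dots> = (\<Sum>j\<le>N. if j = k then coeff ?q k else 0)"
    using assms by (intro sum.cong) auto
  finally show ?thesis
    using assms by simp
qed

lemma coeff_sym_poly_0:
  assumes "A \<in> carrier_mat N N"
  shows "coeff (sym_poly N A) 0 = det A" "coeff (sym_poly N A) N = det A"
proof -
  have "poly (sym_poly N A) 0 = det A"
    using assms by (simp add: poly_sym_poly det_sym_mat_swap[of N 0 1] sym_mat_1_0)
  then show "coeff (sym_poly N A) 0 = det A"
    by (simp add: poly_0_coeff_0)
  then show "coeff (sym_poly N A) N = det A"
    using coeff_sym_poly_palindrome[of 0 N A] by simp
qed

text \<open>Pairs k with N - k. For even N the middle index is its own partner and would be counted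
  twice, hence the division by 2; \<open>?L\<close> holds the indices with a distinct
  partner.\<close>

lemma sum_pair_symmetric:
  fixes g :: "nat \<Rightarrow> complex"
  assumes "N \<ge> 1"
  shows "(\<Sum>k\<le>N. g k)
    = g 0 + g N + (\<Sum>p = 1..N div 2. (g p + g (N - p)) / (if 2 * p = N then 2 else 1))"
proof -
  let ?H = "{1..N div 2}" and ?L = "{p \<in> {1..N div 2}. 2 * p \<noteq> N}"
  have "{..N} = {0, N} \<union> ({1..N div 2} \<union> (\<lambda>p. N - p) ` ?L)"
  proof (intro equalityI subsetI)
    fix k assume k: "k \<in> {..N}"
    show "k \<in> {0, N} \<union> ({1..N div 2} \<union> (\<lambda>p. N - p) ` ?L)"
    proof (cases "k = 0 \<or> k = N \<or> k \<le> N div 2")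
      case False
      then have "N - k \<in> ?L" "k = N - (N - k)"
        using k by auto
      then show ?thesis
        by blast
    qed (use k in auto)
  qed auto
  then have "(\<Sum>k\<le>N. g k) = sum g ({0, N} \<union> ({1..N div 2} \<union> (\<lambda>p. N - p) ` ?L))"
    by simp
  also have "\<dots> = sum g {0, N} + sum g ({1..N div 2} \<union> (\<lambda>p. N - p) ` ?L)"
    using assms by (intro sum.union_disjoint) auto
  also have "sum g ({1..N div 2} \<union> (\<lambda>p. N - p) ` ?L) = sum g ?H + sum g ((\<lambda>p. N - p) ` ?L)"
    by (intro sum.union_disjoint) auto
  also have "sum g ((\<lambda>p. N - p) ` ?L) = (\<Sum>p\<in>?L. g (N - p))"
    by (subst sum.reindex) (auto simp: inj_on_def)
  also have "\<dots> = (\<Sum>p\<in>?H. if 2 * p = N then 0 else g (N - p))"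
    by (intro sum.mono_neutral_cong_left) auto
  also have "sum g ?H + \<dots> = (\<Sum>p\<in>?H. (g p + g (N - p)) / (if 2 * p = N then 2 else 1))"
    unfolding sum.distrib[symmetric]
  proof (intro sum.cong refl)
    fix p assume "p \<in> ?H"
    show "g p + (if 2 * p = N then 0 else g (N - p)) = (g p + g (N - p)) / (if 2 * p = N then 2 else 1)"
    proof (cases "2 * p = N")
      case True
      then have "N - p = p"
        by linarith
      then show ?thesis
        using True by simp
    qed simp
  qed
  finally show ?thesis
    using assms by simp
qed

text \<open>Taking out 1/z leaves z^2 A + A^T, so the coefficient of w^k belongs to the exponent 2k
  - N; palindromy then groups k with N - k.\<close>

lemma Y_fun_expansion:
  assumes A: "A \<in> carrier_mat N N" "det A \<noteq> 0" and z: "z \<noteq> 0" and N: "N \<ge> 1"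
  shows "det (z \<cdot>\<^sub>m A + inverse z \<cdot>\<^sub>m transpose_mat A) / det A =
     (z powi int N + z powi (- int N)) +
     (\<Sum>p = 1..N div 2. (z powi (int N - 2 * int p) + z powi (2 * int p - int N)) * Y_fun N p A)"
proof -
  define c where "c k = coeff (sym_poly N A) k / det A" for k
  define g where "g k = c k * z powi (2 * int k - int N)" for k
  have "z \<cdot>\<^sub>m A + inverse z \<cdot>\<^sub>m transpose_mat A = sym_mat N z (inverse z) A"
    using A by (auto simp: sym_mat_def)
  then have "det (z \<cdot>\<^sub>m A + inverse z \<cdot>\<^sub>m transpose_mat A) / det A
      = inverse z ^ N * poly (sym_poly N A) (z ^ 2) / det A"
    using det_sym_mat_eq_poly[of "inverse z" N z A] z
    by (simp add: power2_eq_square divide_inverse)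
  also have "\<dots> = (\<Sum>k\<le>N. inverse z ^ N * (coeff (sym_poly N A) k * (z\<^sup>2) ^ k) / det A)"
    by (simp add: poly_sum_upto[OF degree_sym_poly] sum_distrib_left sum_divide_distrib)
  also have "\<dots> = (\<Sum>k\<le>N. g k)"
  proof (intro sum.cong refl)
    fix k
    have "z powi (int (2 * k) - int N) = z ^ (2 * k) / z ^ N"
      using z by (simp add: power_int_diff del: of_nat_mult)
    then have "z powi (2 * int k - int N) = (z\<^sup>2) ^ k * inverse z ^ N"
      by (simp add: power_mult divide_inverse power_inverse)
    then show "inverse z ^ N * (coeff (sym_poly N A) k * (z\<^sup>2) ^ k) / det A = g k"
      by (simp add: g_def c_def)
  qed
  also have "\<dots> = g 0 + g N + (\<Sum>p = 1..N div 2. (g p + g (N - p)) / (if 2 * p = N then 2 else 1))"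
    by (rule sum_pair_symmetric[OF N])
  also have "g 0 + g N = z powi int N + z powi (- int N)"
    using A by (simp add: g_def c_def coeff_sym_poly_0)
  also have "(\<Sum>p = 1..N div 2. (g p + g (N - p)) / (if 2 * p = N then 2 else 1))
      = (\<Sum>p = 1..N div 2. (z powi (int N - 2 * int p) + z powi (2 * int p - int N)) * Y_fun N p A)"
  proof (intro sum.cong refl)
    fix p assume "p \<in> {1..N div 2}"
    then have p: "p \<le> N"
      by auto
    then have "2 * int (N - p) - int N = int N - 2 * int p"
      by (simp add: of_nat_diff)
    then have gN: "g (N - p) = c p * z powi (int N - 2 * int p)"
      using p by (simp only: g_def c_def coeff_sym_poly_palindrome)
    have Y: "Y_fun N p A = c p / (if 2 * p = N then 2 else 1)"
      by (simp add: c_def Y_fun_def mult.commute)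
    show "(g p + g (N - p)) / (if 2 * p = N then 2 else 1)
        = (z powi (int N - 2 * int p) + z powi (2 * int p - int N)) * Y_fun N p A"
      unfolding gN Y g_def[of p] by (simp add: distrib_left distrib_right add.commute mult.commute add_divide_distrib)
  qed
  finally show ?thesis .
qed

text \<open>Lagrange interpolation at \<open>0, \<dots>, N\<close>: it transfers the bracket relations from the values of
  \<open>det (w A + A\<^sup>T)\<close> as a polynomial in \<open>w\<close> to its coefficients.\<close>

lemma coeff_interpolation:
  fixes k N :: nat
  shows "\<exists>a :: nat \<Rightarrow> complex. \<forall>q. degree q \<le> N \<longrightarrow>
    coeff q k = (\<Sum>j\<le>N. a j * poly q (of_nat j))"
proof -
  define L :: "nat \<Rightarrow> complex poly" where
    "L j = (\<Prod>i\<in>{..N} - {j}. smult (1 / (of_nat j - of_nat i)) [:- of_nat i, 1:])" for j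
  have L: "poly (L j) (of_nat m) = (if j = m then 1 else 0)" if "j \<le> N" "m \<le> N" for j m
  proof -
    have "poly (smult (1 / (of_nat j - of_nat i)) [:- of_nat i, 1 :: complex:]) (of_nat m)
        = (of_nat m - of_nat i) / (of_nat j - of_nat i)" for i
      by (simp add: diff_divide_distrib)
    then show ?thesis
      using that by (auto simp: L_def poly_prod)
  qed
  have degL: "degree (L j) \<le> N" if "j \<le> N" for j
  proof -
    have "degree (L j) \<le> (\<Sum>i\<in>{..N} - {j}. degree (smult (1 / (of_nat j - of_nat i)) [:- of_nat i, 1 :: complex:]))"
      unfolding L_def by (rule degree_prod_sum_le[unfolded o_def]) simp
    also have "\<dots> \<le> (\<Sum>i\<in>{..N} - {j}. 1)"
      by (intro sum_mono) (simp add: degree_smult_le[THEN order_trans])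
    also have "\<dots> = N"
      using that by simp
    finally show ?thesis .
  qed
  have *: "coeff q k = (\<Sum>j\<le>N. coeff (L j) k * poly q (of_nat j))" if q: "degree q \<le> N" for q
  proof -
    have "q = (\<Sum>j\<le>N. smult (poly q (of_nat j)) (L j))"
    proof (rule poly_eqI_degree[where A = "of_nat ` {..N}"])
      have "card (of_nat ` {..N} :: complex set) = N + 1"
        by (subst card_image) (auto intro: inj_of_nat[THEN inj_on_subset])
      moreover have "degree (\<Sum>j\<le>N. smult (poly q (of_nat j)) (L j)) \<le> N"
        by (intro degree_sum_le) (auto intro: degree_smult_le[THEN order_trans] degL)
      ultimately show "card (of_nat ` {..N} :: complex set) > degree (\<Sum>j\<le>N. smult (poly q (of_nat j)) (L j))"
        "card (of_nat ` {..N} :: complex set) > degree q"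
        using q by simp_all
      fix x :: complex assume "x \<in> of_nat ` {..N}"
      then obtain m where m: "m \<le> N" "x = of_nat m"
        by auto
      have "poly (\<Sum>j\<le>N. smult (poly q (of_nat j)) (L j)) x
          = (\<Sum>j\<le>N. if j = m then poly q x else 0)"
        unfolding poly_sum m(2) using m(1) by (intro sum.cong refl) (auto simp: L)
      then show "poly q x = poly (\<Sum>j\<le>N. smult (poly q (of_nat j)) (L j)) x"
        using m by simp
    qed
    then have "coeff q k = coeff (\<Sum>j\<le>N. smult (poly q (of_nat j)) (L j)) k"
      by (rule arg_cong)
    then show ?thesis
      by (simp add: coeff_sum mult.commute)
  qed
  show ?thesis
    by (intro exI[of _ "\<lambda>j. coeff (L j) k"] allI impI) (rule *)
qed

text \<open>Each value det (j A + A^T) has the weight of det A, and so has the combination that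
  yields the coefficient; the quotient has weight 0.\<close>

lemma casimir_Y_fun: "casimir_on N (nondegenerate N) (\<lambda>(A, B). Y_fun N p A)"
proof -
  obtain a :: "nat \<Rightarrow> complex" where a: "\<And>q. degree q \<le> N \<Longrightarrow> coeff q p = (\<Sum>j\<le>N. a j * poly q (of_nat j))"
    using coeff_interpolation[of N p] by auto
  define m :: complex where "m = (if 2 * p = N then 2 else 1)"
  have "Y_fun N p A = (\<Sum>j\<le>N. a j / m * det (sym_mat N (of_nat j) 1 A)) * inverse (det A)" for A
  proof -
    have "(\<Sum>j\<le>N. a j / m * det (sym_mat N (of_nat j) 1 A))
        = (\<Sum>j\<le>N. a j * det (sym_mat N (of_nat j) 1 A)) / m"
      by (simp add: sum_divide_distrib)
    then show ?thesis
      unfolding Y_fun_def a[OF degree_sym_poly] poly_sym_poly m_def by (simp add: divide_inverse)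
  qed
  then have eq: "(\<lambda>(A, B). Y_fun N p A)
      = (\<lambda>y. (\<Sum>j\<le>N. a j / m * det (sym_mat N (of_nat j) 1 (fst y))) * inverse (det (fst y)))"
    by (simp add: fun_eq_iff)
  show ?thesis
    unfolding eq
  proof (rule casimir_on_weight_0)
    show "nondegenerate N \<subseteq> points N"
      using nondegenerate_points by blast
    show "rational_on N (nondegenerate N)
      (\<lambda>y. (\<Sum>j\<le>N. a j / m * det (sym_mat N (of_nat j) 1 (fst y))) * inverse (det (fst y)))"
      unfolding sym_mat_def entry_simps(1)[symmetric]
      by (intro rational_on_mult rational_on_sum rational_on_const rational_on_inverse
          rational_on_det_A rational_on_det rational_on_add rational_on_entry)
        (auto simp: nondegenerate_def)
    fix x w assume x: "x \<in> nondegenerate N" and w: "w \<in> coords N"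
    note xp = nondegenerate_points[OF x]
    have "has_weight N x w
        (\<lambda>y. (\<Sum>j\<le>N. a j / m * det (sym_mat N (of_nat j) 1 (fst y))) * inverse (det (fst y)))
        (sym_weight w + - sym_weight w)"
      using x
      by (intro has_weight_mult has_weight_linear_combination has_weight_inverse has_weight_sym
          has_weight_det_A xp w) (auto simp: nondegenerate_def)
    then show "has_weight N x w
        (\<lambda>y. (\<Sum>j\<le>N. a j / m * det (sym_mat N (of_nat j) 1 (fst y))) * inverse (det (fst y))) 0"
      by simp
  qed
qed

text \<open>Comparison of coefficients. For N = 2p both monomials of the pair coincide, and the
  resulting 2 cancels the one in \<open>Y_fun\<close>.\<close>

lemma Y_fun_unique:
  assumes det: "det A \<noteq> 0"
    and eq: "\<And>w. w \<noteq> 0 \<Longrightarrow> poly (sym_poly N A) w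
      = det A * (w ^ N + 1 + (\<Sum>r = 1..N div 2. y r * (w ^ (N - r) + w ^ r)))"
    and p: "p \<in> {1..N div 2}"
  shows "Y_fun N p A = y p"
proof -
  have "sym_poly N A = smult (det A) (monom 1 N + 1
      + (\<Sum>r = 1..N div 2. smult (y r) (monom 1 (N - r) + monom 1 r)))"
    by (rule poly_eqI_nonzero) (simp add: eq poly_sum poly_monom)
  then have "coeff (sym_poly N A) p = det A * (\<Sum>r = 1..N div 2.
      y r * ((if N - r = p then 1 else 0) + (if r = p then 1 else 0)))"
    using p by (auto simp: coeff_sum)
  also have "(\<Sum>r = 1..N div 2. y r * ((if N - r = p then 1 else 0) + (if r = p then 1 else 0)))
      = (\<Sum>r = 1..N div 2. if r = p then y p * (if 2 * p = N then 2 else 1) else 0)"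
    using p by (intro sum.cong refl) auto
  finally show ?thesis
    using p det by (simp add: Y_fun_def)
qed

subsection \<open>Polynomials and palindromic factorization\<close>

text \<open>Base-K digits are recovered successively modulo K. This keeps the exponents of the
  Kronecker substitution apart.\<close>

lemma digits_unique:
  fixes a b :: "nat \<Rightarrow> nat"
  assumes "\<And>i. i < n \<Longrightarrow> a i < K \<and> b i < K"
    and "(\<Sum>i<n. a i * K ^ i) = (\<Sum>i<n. b i * K ^ i)" and "i < n"
  shows "a i = b i"
  using assms
proof (induction n arbitrary: a b i)
  case (Suc n)
  have shift: "(\<Sum>i<Suc n. c i * K ^ i) = c 0 + K * (\<Sum>i<n. c (Suc i) * K ^ i)" for c :: "nat \<Rightarrow> nat"
    by (simp add: sum.lessThan_Suc_shift sum_distrib_left ac_simps del: sum.lessThan_Suc)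
  have eq: "a 0 + K * (\<Sum>i<n. a (Suc i) * K ^ i) = b 0 + K * (\<Sum>i<n. b (Suc i) * K ^ i)"
    using Suc.prems(2) unfolding shift .
  have lt: "a 0 < K" "b 0 < K"
    using Suc.prems(1)[of 0] by auto
  have "(a 0 + K * (\<Sum>i<n. a (Suc i) * K ^ i)) mod K = (b 0 + K * (\<Sum>i<n. b (Suc i) * K ^ i)) mod K"
    unfolding eq ..
  then have 0: "a 0 = b 0"
    using lt by simp
  then have "(\<Sum>i<n. a (Suc i) * K ^ i) = (\<Sum>i<n. b (Suc i) * K ^ i)"
    using eq lt by simp
  then have "a (Suc j) = b (Suc j)" if "j < n" for j
    using Suc.IH[of "\<lambda>i. a (Suc i)" "\<lambda>i. b (Suc i)" j] Suc.prems(1) that by simp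
  with 0 show ?case
    using Suc.prems(3) by (cases i) auto
qed simp

text \<open>Kronecker substitution: replacing the variables by sufficiently sparse powers of one
  unknown \<open>t\<close> keeps distinct monomials apart.\<close>

lemma cpoly_nonvanishing_point:
  fixes P :: "'v cpoly"
  assumes "P \<noteq> 0"
  shows "\<exists>x. (\<forall>v. x v \<noteq> 0) \<and> cpoly_eval P x \<noteq> 0"
proof -
  let ?S = "Poly_Mapping.keys P"
  define V where "V = cpoly_vars P"
  have fV: "finite V"
    by (simp add: V_def cpoly_vars_def)
  \<comment> \<open>A base larger than every single exponent occurring in P.\<close>
  define K where "K = Suc (\<Sum>m\<in>?S. \<Sum>v\<in>V. Poly_Mapping.lookup m v)"
  have K: "Poly_Mapping.lookup m v < K" if "m \<in> ?S" "v \<in> V" for m v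
  proof -
    have "Poly_Mapping.lookup m v \<le> (\<Sum>v\<in>V. Poly_Mapping.lookup m v)"
      using that fV by (intro member_le_sum) auto
    also have "\<dots> \<le> (\<Sum>m\<in>?S. \<Sum>v\<in>V. Poly_Mapping.lookup m v)"
      using that by (intro member_le_sum[where f = "\<lambda>m. \<Sum>v\<in>V. Poly_Mapping.lookup m v"]) auto
    finally show ?thesis
      by (simp add: K_def)
  qed
  obtain h where h: "bij_betw h {0..<card V} V"
    using ex_bij_betw_nat_finite[OF fV] by blast
  define e where "e = inv_into {0..<card V} h"
  have e: "e (h i) = i" if "i < card V" for i
    using h that by (simp add: e_def bij_betw_def)
  \<comment> \<open>The number whose base-K digits are the exponents of \<open>m\<close>.\<close>
  define W where "W m = (\<Sum>v\<in>V. Poly_Mapping.lookup m v * K ^ e v)" for m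
  have W: "W m = (\<Sum>i<card V. Poly_Mapping.lookup m (h i) * K ^ i)" for m
    unfolding W_def sum.reindex_bij_betw[OF h, symmetric] by (auto simp: e atLeast0LessThan)
  have inj: "m = m'" if m: "m \<in> ?S" "m' \<in> ?S" and eq: "W m = W m'" for m m'
  proof (rule poly_mapping_eqI)
    fix v
    show "Poly_Mapping.lookup m v = Poly_Mapping.lookup m' v"
    proof (cases "v \<in> V")
      case True
      then have "v \<in> h ` {0..<card V}"
        using bij_betw_imp_surj_on[OF h] by simp
      then obtain i where i: "i < card V" "v = h i"
        by auto
      have hV: "h j \<in> V" if "j < card V" for j
        using h that by (auto simp: bij_betw_def)
      show ?thesis
        unfolding i(2)
        by (rule digits_unique[OF _ eq[unfolded W] i(1)]) (use hV K m in auto)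
    next
      case False
      then show ?thesis
        using m by (auto simp: V_def cpoly_vars_def in_keys_iff)
    qed
  qed
  define x where "x t v = t ^ (K ^ e v)" for t :: complex and v
  define Q where "Q = (\<Sum>m\<in>?S. monom (Poly_Mapping.lookup P m) (W m))"
  have mon: "monomial m (x t) = t ^ W m" if "m \<in> ?S" for m t
  proof -
    have "monomial m (x t) = (\<Prod>v\<in>V. x t v ^ Poly_Mapping.lookup m v)"
      using that fV by (intro monomial_superset) (auto simp: V_def cpoly_vars_def)
    then show ?thesis
      by (simp add: W_def power_sum x_def power_mult[symmetric] mult.commute)
  qed
  have eval: "cpoly_eval P (x t) = poly Q t" for t
    by (simp add: cpoly_eval_superset[OF finite_keys order_refl] mon Q_def poly_sum poly_monom)
  obtain m0 where m0: "m0 \<in> ?S"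
    using assms by (metis all_not_in_conv keys_eq_empty)
  have "coeff Q (W m0) = (\<Sum>m\<in>?S. if m = m0 then Poly_Mapping.lookup P m0 else 0)"
    unfolding Q_def coeff_sum using inj m0 by (intro sum.cong refl) auto
  then have "coeff Q (W m0) \<noteq> 0"
    using m0 by (simp add: in_keys_iff)
  then have "Q \<noteq> 0"
    by auto
  \<comment> \<open>A nonzero t makes all coordinates of the point nonzero, as required of values
    for the X_p.\<close>
  then obtain t where "t \<noteq> 0" "poly Q t \<noteq> 0"
    using poly_eqI_nonzero[of Q 0] by auto
  then show ?thesis
    using eval by (intro exI[of _ "x t"]) (auto simp: x_def)
qed

text \<open>Polynomials of Chebyshev type in \<open>w + 1 / w\<close>; the flag distinguishes odd from even \<open>N\<close>.\<close>

fun cheb :: "bool \<Rightarrow> nat \<Rightarrow> complex poly" where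
  "cheb e 0 = (if e then 1 else 2)"
| "cheb e (Suc 0) = (if e then [:-1, 1:] else [:0, 1:])"
| "cheb e (Suc (Suc k)) = [:0, 1:] * cheb e (Suc k) - cheb e k"

lemma degree_cheb: "degree (cheb e k) \<le> k"
proof (induction e k rule: cheb.induct)
  case (3 e k)
  have "degree ([:0, 1:] * cheb e (Suc k)) \<le> Suc (Suc k)"
    using 3(1) by (intro degree_mult_le[THEN order_trans]) simp
  moreover have "degree (cheb e k) \<le> Suc (Suc k)"
    using 3(2) by simp
  ultimately show ?case
    by (simp only: cheb.simps degree_diff_le)
qed auto

text \<open>The excluded case is the constant 2, which stands for w^0 + w^(-0) when N is
  even.\<close>

lemma coeff_cheb: "k \<ge> 1 \<or> e \<Longrightarrow> coeff (cheb e k) k = 1"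
proof (induction e k rule: cheb.induct)
  case (3 e k)
  have "coeff (cheb e k) (Suc (Suc k)) = 0"
    using degree_cheb[of e k] by (intro coeff_eq_0) simp
  then show ?case
    using 3(1) by simp
qed auto

text \<open>Up to the power of w and the factor w + 1, the recursion is the identity (w^2 + 1) (w^m
  + 1) - w^2 (w^(m-2) + 1) = w^(m+2) + 1.\<close>

lemma poly_cheb:
  assumes "w \<noteq> 0"
  shows "(if e then w + 1 else 1) * w ^ k * poly (cheb e k) (w + 1 / w) = w ^ (2 * k + of_bool e) + 1"
proof (induction e k rule: cheb.induct)
  case (1 e)
  then show ?case by simp
next
  case (2 e)
  then show ?case
    using assms by (simp add: field_simps power2_eq_square power3_eq_cube eval_nat_numeral)
next
  case (3 e k)
  let ?f = "if e then w + 1 else 1"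
  have "?f * w ^ Suc (Suc k) * poly (cheb e (Suc (Suc k))) (w + 1 / w)
      = (w * (w + 1 / w)) * (?f * w ^ Suc k * poly (cheb e (Suc k)) (w + 1 / w))
        - w\<^sup>2 * (?f * w ^ k * poly (cheb e k) (w + 1 / w))"
    by (simp add: algebra_simps power2_eq_square)
  also have "\<dots> = (w\<^sup>2 + 1) * (w ^ (2 * Suc k + of_bool e) + 1) - w\<^sup>2 * (w ^ (2 * k + of_bool e) + 1)"
    unfolding 3 using assms by (simp add: algebra_simps power2_eq_square)
  also have "\<dots> = w ^ (2 * Suc (Suc k) + of_bool e) + 1"
    by (simp add: algebra_simps power2_eq_square)
  finally show ?case .
qed

lemma monic_factorization:
  fixes R :: "complex poly"
  assumes "degree R \<le> n" "coeff R n = 1"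
  shows "\<exists>r. R = (\<Prod>i<n. [:- r i, 1:])"
proof -
  have deg: "degree R = n"
    using assms le_degree[of R n] by simp
  then have "R \<noteq> 0"
    using assms by auto
  then obtain M where M: "size M = degree R" "R = smult (lead_coeff R) (\<Prod>x\<in>#M. [:- x, 1:])"
    using alg_closed_imp_factorization by blast
  obtain xs where xs: "mset xs = M"
    using ex_mset by blast
  have len: "length xs = n"
    using M(1) xs deg by auto
  have "R = (\<Prod>x\<in>#mset xs. [:- x, 1:])"
    using M(2) assms(2) deg xs by simp
  also have "\<dots> = prod_list (map (\<lambda>x. [:- x, 1:]) xs)"
    by (metis mset_map prod_mset_prod_list)
  also have "\<dots> = (\<Prod>i<n. [:- (xs ! i), 1:])"
    by (simp add: prod.list_conv_set_nth len atLeast0LessThan)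
  finally show ?thesis
    by blast
qed

text \<open>Prescribes \<rho> + 1/\<rho>; the quadratic has constant term 1, so its root is not
  0.\<close>

lemma ex_sum_reciprocal:
  fixes r :: complex
  shows "\<exists>\<rho>. \<rho> \<noteq> 0 \<and> \<rho>\<^sup>2 + 1 = r * \<rho>"
proof -
  have "degree [:1, - r, 1:] > 0"
    by simp
  then obtain \<rho> where \<rho>: "poly [:1, - r, 1:] \<rho> = 0"
    using alg_closed_imp_poly_has_root by blast
  then have "\<rho>\<^sup>2 + 1 = r * \<rho>"
    by (simp add: algebra_simps power2_eq_square add_eq_0_iff)
  moreover have "\<rho> \<noteq> 0"
    using \<rho> by auto
  ultimately show ?thesis
    by blast
qed

text \<open>Divided by w^h, and by w + 1 for odd N, the palindromic polynomial is a monic polynomial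
  R of degree h in w + 1/w. A root r of R gives the factor w (w + 1/w - r), which is (w \<rho> + 1)
  (w + \<rho>) / \<rho> when \<rho> + 1/\<rho> = -r.\<close>

lemma palindromic_factorization:
  fixes y :: "nat \<Rightarrow> complex"
  assumes "N \<ge> 1"
  shows "\<exists>\<rho>. (\<forall>i. \<rho> i \<noteq> 0) \<and> (\<forall>w. w \<noteq> 0 \<longrightarrow>
     (if odd N then w + 1 else 1) * (\<Prod>i<N div 2. (w * \<rho> i + 1) * (w + \<rho> i)) =
     (\<Prod>i<N div 2. \<rho> i) * (w ^ N + 1 + (\<Sum>p = 1..N div 2. y p * (w ^ (N - p) + w ^ p))))"
proof -
  define h where "h = N div 2"
  define e where "e = odd N"
  have N: "N = 2 * h + of_bool e"
    by (auto simp: h_def e_def)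
  \<comment> \<open>The pair w^(N-p) + w^p is w^p times w^(N-2p) + 1, which is the polynomial with
    index h - p. For N = 2p it is 2 w^p, matching \<open>cheb e 0 = 2\<close>.\<close>
  define R where "R = cheb e h + (\<Sum>p = 1..h. smult (y p) (cheb e (h - p)))"
  have "degree R \<le> h"
    unfolding R_def
    by (intro degree_add_le degree_sum_le)
      (auto intro: degree_cheb degree_smult_le[THEN order_trans] degree_cheb[THEN order_trans])
  moreover have "coeff R h = 1"
  proof -
    have "coeff (cheb e (h - p)) h = 0" if "p \<in> {1..h}" for p
      using degree_cheb[of e "h - p"] that by (intro coeff_eq_0) auto
    moreover have "h \<ge> 1 \<or> e"
      using assms N by (cases e) auto
    ultimately show ?thesis
      by (simp add: R_def coeff_sum coeff_cheb)
  qed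
  ultimately obtain r where r: "R = (\<Prod>i<h. [:- r i, 1:])"
    using monic_factorization by blast
  obtain \<rho> where \<rho>: "\<And>i. \<rho> i \<noteq> 0" "\<And>i. (\<rho> i)\<^sup>2 + 1 = - r i * \<rho> i"
    using ex_sum_reciprocal[of "- r _"] by metis
  have "(if e then w + 1 else 1) * (\<Prod>i<h. (w * \<rho> i + 1) * (w + \<rho> i)) =
     (\<Prod>i<h. \<rho> i) * (w ^ N + 1 + (\<Sum>p = 1..h. y p * (w ^ (N - p) + w ^ p)))" if w: "w \<noteq> 0" for w
  proof -
    let ?f = "if e then w + 1 else 1"
    have "(w * \<rho> i + 1) * (w + \<rho> i) = \<rho> i * (w * (w + 1 / w - r i))" for i
    proof -
      have "(w * \<rho> i + 1) * (w + \<rho> i) = \<rho> i * w\<^sup>2 + w * ((\<rho> i)\<^sup>2 + 1) + \<rho> i"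
        by (simp add: algebra_simps power2_eq_square)
      also have "\<dots> = \<rho> i * (w * (w + 1 / w - r i))"
        unfolding \<rho>(2) using w by (simp add: algebra_simps power2_eq_square)
      finally show ?thesis .
    qed
    then have "?f * (\<Prod>i<h. (w * \<rho> i + 1) * (w + \<rho> i))
        = (\<Prod>i<h. \<rho> i) * (?f * w ^ h * (\<Prod>i<h. w + 1 / w - r i))"
      by (simp add: prod.distrib)
    also have "(\<Prod>i<h. w + 1 / w - r i) = poly R (w + 1 / w)"
      by (simp add: r poly_prod)
    also have "?f * w ^ h * poly R (w + 1 / w) = ?f * w ^ h * poly (cheb e h) (w + 1 / w)
        + (\<Sum>p = 1..h. y p * (?f * w ^ h * poly (cheb e (h - p)) (w + 1 / w)))"
      by (simp add: R_def poly_sum distrib_left sum_distrib_left ac_simps del: cheb.simps)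
    also have "(\<Sum>p = 1..h. y p * (?f * w ^ h * poly (cheb e (h - p)) (w + 1 / w)))
        = (\<Sum>p = 1..h. y p * (w ^ (N - p) + w ^ p))"
    proof (intro sum.cong refl)
      fix p assume "p \<in> {1..h}"
      then have p: "h = p + (h - p)" "2 * (h - p) + of_bool e + p = N - p"
        by (auto simp: N)
      have wh: "w ^ h = w ^ p * w ^ (h - p)"
        using p(1) by (metis power_add)
      have "?f * w ^ h * poly (cheb e (h - p)) (w + 1 / w)
          = w ^ p * (?f * w ^ (h - p) * poly (cheb e (h - p)) (w + 1 / w))"
        unfolding wh by (simp only: ac_simps)
      also have "\<dots> = w ^ (2 * (h - p) + of_bool e + p) + w ^ p"
        unfolding poly_cheb[OF w] by (simp add: algebra_simps power_add)
      finally show "y p * (?f * w ^ h * poly (cheb e (h - p)) (w + 1 / w)) = y p * (w ^ (N - p) + w ^ p)"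
        unfolding p(2) by simp
    qed
    also have "?f * w ^ h * poly (cheb e h) (w + 1 / w) = w ^ N + 1"
      unfolding poly_cheb[OF w] N ..
    finally show ?thesis .
  qed
  then show ?thesis
    using \<rho>(1) unfolding e_def h_def by blast
qed

subsection \<open>Algebraic independence\<close>

text \<open>A shape in which every determinant involved is a product: upper-right corners stay
  antidiagonal, transposition reverses the entries, and S becomes diagonal.\<close>

definition antidiag :: "nat \<Rightarrow> (nat \<Rightarrow> complex) \<Rightarrow> complex mat" where
  "antidiag n a = mat n n (\<lambda>(i, j). if i + j + 1 = n then a i else 0)"

lemma antidiag_carrier [simp]: "antidiag n a \<in> carrier_mat n n"
  by (simp add: antidiag_def)

lemma antidiag_sum:
  fixes f :: "nat \<Rightarrow> complex"
  assumes "i < n"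
  shows "(\<Sum>k<n. (if i + k + 1 = n then f k else 0)) = f (n - 1 - i)"
proof -
  have "i + k + 1 = n \<longleftrightarrow> k = n - 1 - i" for k
    using assms by auto
  then have "(\<Sum>k<n. (if i + k + 1 = n then f k else 0)) = (\<Sum>k<n. (if k = n - 1 - i then f k else 0))"
    by simp
  then show ?thesis
    using assms by simp
qed

lemma det_mat_diag: "det (mat_diag n f) = (\<Prod>i<n. f i)"
  by (subst det_upper_triangular[of _ n])
    (auto simp: mat_diag_def prod_list_diag_prod atLeast0LessThan)

text \<open>The sign of the reversal stays an unevaluated factor, since only its being nonzero
  matters.\<close>

lemma det_antidiag: "det (antidiag n a) = det (antidiag n (\<lambda>_. 1)) * (\<Prod>i<n. a i)"
proof -
  have "antidiag n a = mat_diag n a * antidiag n (\<lambda>_. 1)"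
    by (subst mat_diag_mult_left[of _ n n]) (auto simp: antidiag_def)
  then show ?thesis
    by (simp add: det_mult[of _ n] det_mat_diag mult.commute)
qed

lemma det_antidiag_1: "det (antidiag n (\<lambda>_. 1)) \<noteq> 0"
proof -
  have "antidiag n (\<lambda>_. 1) * antidiag n (\<lambda>_. 1) = 1\<^sub>m n"
  proof (rule eq_matI)
    fix i j assume ij: "i < dim_row (1\<^sub>m n)" "j < dim_col (1\<^sub>m n)"
    then have "(antidiag n (\<lambda>_. 1) * antidiag n (\<lambda>_. 1)) $$ (i, j)
        = (\<Sum>k<n. if i + k + 1 = n then (if k + j + 1 = n then 1 else 0) else 0)"
      by (auto simp: antidiag_def scalar_prod_def atLeast0LessThan intro!: sum.cong)
    also have "\<dots> = (1\<^sub>m n $$ (i, j) :: complex)"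
      using ij by (subst antidiag_sum) auto
    finally show "(antidiag n (\<lambda>_. 1) * antidiag n (\<lambda>_. 1)) $$ (i, j) = 1\<^sub>m n $$ (i, j)" .
  qed (auto simp: antidiag_def)
  then have "det (antidiag n (\<lambda>_. 1)) * det (antidiag n (\<lambda>_. 1)) = 1"
    by (metis antidiag_carrier det_mult det_one)
  then show ?thesis
    by auto
qed

lemma corner_B_antidiag:
  assumes "q \<le> N"
  shows "corner_B N q (antidiag N b) = antidiag q b"
  using assms by (intro eq_matI) (auto simp: corner_B_def antidiag_def)

lemma sym_mat_antidiag:
  "sym_mat N z v (antidiag N a) = antidiag N (\<lambda>i. z * a i + v * a (N - 1 - i))"
proof (rule eq_matI)
  fix i j assume "i < dim_row (antidiag N (\<lambda>i. z * a i + v * a (N - 1 - i)))"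
    "j < dim_col (antidiag N (\<lambda>i. z * a i + v * a (N - 1 - i)))"
  then have ij: "i < N" "j < N"
    by (auto simp: antidiag_def)
  then have "i + j + 1 = N \<Longrightarrow> N - 1 - i = j"
    by auto
  with ij show "sym_mat N z v (antidiag N a) $$ (i, j) = antidiag N (\<lambda>i. z * a i + v * a (N - 1 - i)) $$ (i, j)"
    by (auto simp: sym_mat_def antidiag_def)
qed (auto simp: sym_mat_def antidiag_def)

lemma nondegenerate_antidiag:
  assumes "\<And>i. i < N \<Longrightarrow> a i \<noteq> 0" "\<And>i. i < N \<Longrightarrow> b i \<noteq> 0"
  shows "(antidiag N a, antidiag N b) \<in> nondegenerate N"
  using assms det_antidiag[of N a] det_antidiag[of N b] det_antidiag_1[of N]
  by (auto simp: nondegenerate_def)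

text \<open>S is identified with a diagonal matrix by cancelling B in S B = A^T, without computing
  the inverse.\<close>

lemma corner_S_antidiag:
  assumes nz: "\<And>i. i < N \<Longrightarrow> a i \<noteq> 0" "\<And>i. i < N \<Longrightarrow> b i \<noteq> 0" and q: "q \<le> N"
  shows "det (corner_S q (antidiag N a) (antidiag N b)) = (\<Prod>i<q. a (N - 1 - i) / b i)"
proof -
  note AB = nondegenerate_antidiag[OF nz]
  have S: "S_mat (antidiag N a) (antidiag N b) $$ (i, j) = (if i = j then a (N - 1 - i) / b i else 0)"
    if i: "i < N" and "j < N" for i j
  proof (rule right_mult_B_inj[OF AB _ \<open>j < N\<close>])
    fix m assume m: "m < N"
    have "(\<Sum>j<N. (if i = j then a (N - 1 - i) / b i else 0) * antidiag N b $$ (j, m))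
        = (\<Sum>j<N. if i = j then a (N - 1 - i) / b i * antidiag N b $$ (j, m) else 0)"
      by (intro sum.cong) auto
    also have "\<dots> = a (N - 1 - i) / b i * antidiag N b $$ (i, m)"
      using i by simp
    also have "\<dots> = antidiag N a $$ (m, i)"
    proof (cases "i + m + 1 = N")
      case True
      then have "N - 1 - i = m"
        by linarith
      then show ?thesis
        using True i m nz by (simp add: antidiag_def add.commute)
    qed (use i m in \<open>simp add: antidiag_def add.commute\<close>)
    finally show "(\<Sum>j<N. S_mat (antidiag N a) (antidiag N b) $$ (i, j) * antidiag N b $$ (j, m))
      = (\<Sum>j<N. (if i = j then a (N - 1 - i) / b i else 0) * antidiag N b $$ (j, m))"
      using S_mat_sum[OF AB i m] by simp
  qed
  have "corner_S q (antidiag N a) (antidiag N b) = mat_diag q (\<lambda>i. a (N - 1 - i) / b i)"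
    using q by (auto simp: corner_S_def mat_diag_def S)
  then show ?thesis
    by (simp only: det_mat_diag)
qed

section \<open>Realizing prescribed values of the Casimir functions\<close>

lemma prod_telescope_nonzero:
  fixes \<delta> :: "nat \<Rightarrow> complex"
  assumes "\<And>i. \<delta> i \<noteq> 0"
  shows "(\<Prod>i<n. \<delta> (Suc i) / \<delta> i) = \<delta> n / \<delta> 0"
  using assms by (induction n) auto

text \<open>A is fixed first, by the values y. In terms of the partial products \<delta> of the
  entries of B, X_p is then a nonzero constant times (\<delta>_N / (\<delta>_p \<delta>_(N-p)))^2;
  keeping \<delta> constant from h on leaves 1 / \<delta>_p^2.\<close>

lemma antidiag_realization:
  fixes y \<xi> :: "nat \<Rightarrow> complex"
  assumes N: "N \<ge> 1" and \<xi>: "\<And>p. \<xi> p \<noteq> 0"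
  shows "\<exists>A B. (A, B) \<in> generic N \<and>
     (\<forall>p\<in>{1..N div 2}. Y_fun N p A = y p \<and> X_fun N p (A, B) = \<xi> p)"
proof -
  define h where "h = N div 2"
  obtain \<rho> where \<rho>: "\<And>i. \<rho> i \<noteq> 0" "\<And>w. w \<noteq> 0 \<Longrightarrow>
     (if odd N then w + 1 else 1) * (\<Prod>i<h. (w * \<rho> i + 1) * (w + \<rho> i)) =
     (\<Prod>i<h. \<rho> i) * (w ^ N + 1 + (\<Sum>p = 1..h. y p * (w ^ (N - p) + w ^ p)))"
    using palindromic_factorization[OF N, of y] unfolding h_def by blast
  \<comment> \<open>The entry \<rho> i is opposite to an entry 1, so the pair i, N - 1 - i
    contributes (w \<rho> i + 1) (w + \<rho> i).\<close>
  define a where "a i = (if i < h then \<rho> i else 1)" for i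
  define A where "A = antidiag N a"
  have a: "a i \<noteq> 0" for i
    using \<rho>(1) by (simp add: a_def)
  \<comment> \<open>Pairs i with N - 1 - i; for odd N the index h is its own partner.\<close>
  have split: "(\<Prod>i<N. g i) = (if odd N then g h else 1) * (\<Prod>i<h. g i * g (N - 1 - i))"
    for g :: "nat \<Rightarrow> complex"
  proof -
    have "{..<N} = {..<h} \<union> ((if odd N then {h} else {}) \<union> (\<lambda>i. N - 1 - i) ` {..<h})"
    proof (intro equalityI subsetI)
      fix k assume k: "k \<in> {..<N}"
      show "k \<in> {..<h} \<union> ((if odd N then {h} else {}) \<union> (\<lambda>i. N - 1 - i) ` {..<h})"
      proof (cases "k < h \<or> (odd N \<and> k = h)")
        case False
        then have "N - 1 - k < h" "k = N - 1 - (N - 1 - k)"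
          using k by (auto simp: h_def)
        then show ?thesis
          by blast
      qed auto
    qed (use N in \<open>auto simp: h_def split: if_splits\<close>)
    then have "(\<Prod>i<N. g i) = prod g ({..<h} \<union> ((if odd N then {h} else {}) \<union> (\<lambda>i. N - 1 - i) ` {..<h}))"
      by simp
    also have "\<dots> = prod g {..<h} * prod g ((if odd N then {h} else {}) \<union> (\<lambda>i. N - 1 - i) ` {..<h})"
      by (intro prod.union_disjoint) (auto simp: h_def split: if_splits)
    also have "prod g ((if odd N then {h} else {}) \<union> (\<lambda>i. N - 1 - i) ` {..<h})
        = prod g (if odd N then {h} else {}) * prod g ((\<lambda>i. N - 1 - i) ` {..<h})"
      by (intro prod.union_disjoint) (auto simp: h_def elim!: oddE split: if_splits)
    also have "prod g ((\<lambda>i. N - 1 - i) ` {..<h}) = (\<Prod>i<h. g (N - 1 - i))"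
      by (subst prod.reindex) (auto simp: inj_on_def h_def)
    finally show ?thesis
      by (simp add: prod.distrib)
  qed
  have far: "a (N - 1 - i) = 1" if "i < h" for i
    using that by (auto simp: a_def h_def)
  have near: "N - 1 - (N - 1 - i) = i" if "i < h" for i
    using that by (auto simp: h_def)
  have mid: "a h = 1" "odd N \<Longrightarrow> N - 1 - h = h"
    by (auto simp: a_def h_def elim!: oddE)
  have prod_a: "(\<Prod>i<N. a i) = (\<Prod>i<h. \<rho> i)"
    unfolding split[of a] using mid far by (simp add: a_def)
  define \<kappa> where "\<kappa> n = det (antidiag n (\<lambda>_. 1))" for n
  have \<kappa>: "\<kappa> n \<noteq> 0" for n
    by (simp add: \<kappa>_def det_antidiag_1)
  have detA: "det A = \<kappa> N * (\<Prod>i<N. a i)"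
    unfolding A_def \<kappa>_def by (rule det_antidiag)
  have Y: "Y_fun N p A = y p" if "p \<in> {1..N div 2}" for p
  proof (rule Y_fun_unique[OF _ _ that])
    show "det A \<noteq> 0"
      using detA \<kappa> a by simp
    fix w :: complex assume w: "w \<noteq> 0"
    have "poly (sym_poly N A) w = \<kappa> N * (\<Prod>i<N. w * a i + 1 * a (N - 1 - i))"
      unfolding poly_sym_poly A_def sym_mat_antidiag \<kappa>_def by (rule det_antidiag)
    also have "(\<Prod>i<N. w * a i + 1 * a (N - 1 - i))
        = (if odd N then w + 1 else 1) * (\<Prod>i<h. (w * \<rho> i + 1) * (w + \<rho> i))"
    proof -
      have "(\<Prod>i<h. (w * a i + 1 * a (N - 1 - i)) * (w * a (N - 1 - i) + 1 * a (N - 1 - (N - 1 - i))))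
          = (\<Prod>i<h. (w * \<rho> i + 1) * (w + \<rho> i))"
      proof (rule prod.cong[OF refl])
        fix i assume "i \<in> {..<h}"
        then have i: "i < h" by simp
        show "(w * a i + 1 * a (N - 1 - i)) * (w * a (N - 1 - i) + 1 * a (N - 1 - (N - 1 - i)))
            = (w * \<rho> i + 1) * (w + \<rho> i)"
          unfolding near[OF i] far[OF i] using i by (simp add: a_def)
      qed
      then show ?thesis
        unfolding split using mid by simp
    qed
    also have "\<dots> = (\<Prod>i<N. a i) * (w ^ N + 1 + (\<Sum>p = 1..h. y p * (w ^ (N - p) + w ^ p)))"
      unfolding prod_a by (rule \<rho>(2)[OF w])
    finally show "poly (sym_poly N A) w
        = det A * (w ^ N + 1 + (\<Sum>r = 1..N div 2. y r * (w ^ (N - r) + w ^ r)))"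
      by (simp add: detA h_def)
  qed
  define \<alpha> where "\<alpha> q = (\<Prod>i<q. a (N - 1 - i))" for q
  have \<alpha>: "\<alpha> q \<noteq> 0" for q
    using a by (simp add: \<alpha>_def)
  \<comment> \<open>The value of X_p when all partial products \<delta> are 1.\<close>
  define C where "C p = \<alpha> p * \<alpha> (N - p) * \<kappa> N / (\<kappa> (N - p) * \<kappa> p * (\<Prod>i<N. a i))" for p
  have C: "C p \<noteq> 0" for p
    using \<alpha> \<kappa> a by (simp add: C_def)
  \<comment> \<open>The square root solves C p / \<delta>_p^2 = \<xi> p for 1 \<le> p \<le> h;
    \<delta>_0 = 1 is the empty product, and beyond h the value at h is repeated.\<close>
  define \<delta> where "\<delta> p = (if p \<in> {1..h} then csqrt (C p / \<xi> p) else if p = 0 then 1 else csqrt (C h / \<xi> h))" for p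
  have \<delta>: "\<delta> p \<noteq> 0" for p
    using C \<xi> by (simp add: \<delta>_def)
  have \<delta>_far: "\<delta> p = \<delta> N" if "h \<le> p" "p \<le> N" "1 \<le> p" for p
    using that N by (auto simp: \<delta>_def h_def)
  \<comment> \<open>Ratios, so that the partial products telescope to \<delta>.\<close>
  define b where "b i = \<delta> (Suc i) / \<delta> i" for i
  define B where "B = antidiag N b"
  have b: "b i \<noteq> 0" for i
    using \<delta> by (simp add: b_def)
  have prod_b: "(\<Prod>i<q. b i) = \<delta> q" for q
  proof -
    have "\<delta> 0 = 1"
      by (simp add: \<delta>_def)
    then show ?thesis
      using prod_telescope_nonzero[of \<delta> q] \<delta> by (simp add: b_def)
  qed
  have nd: "(A, B) \<in> nondegenerate N"
    unfolding A_def B_def by (rule nondegenerate_antidiag[OF a b])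
  have cB: "det (corner_B N q B) = \<kappa> q * \<delta> q" if "q \<le> N" for q
    unfolding B_def corner_B_antidiag[OF that] det_antidiag[of q b] prod_b \<kappa>_def ..
  have cS: "det (corner_S q A B) = \<alpha> q / \<delta> q" if "q \<le> N" for q
    unfolding A_def B_def corner_S_antidiag[OF a b that] prod_dividef prod_b \<alpha>_def ..
  have detB: "det B = \<kappa> N * \<delta> N"
    using cB[of N] by (simp add: corner_B_full B_def)
  have "(A, B) \<in> generic N"
    using nd cB \<kappa> \<delta>
    by (auto simp: generic_def X_domain_def nondegenerate_def minor_B_corner)
  moreover have "X_fun N p (A, B) = \<xi> p" if p: "p \<in> {1..N div 2}" for p
  proof -
    have pN: "p \<le> N" "N - p \<le> N" "p \<le> h" "p \<ge> 1"
      using p by (auto simp: h_def)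
    have \<delta>Np: "\<delta> (N - p) = \<delta> N"
      using p by (intro \<delta>_far) (auto simp: h_def)
    have \<delta>2: "(\<delta> p)\<^sup>2 = C p / \<xi> p"
      using pN by (simp add: \<delta>_def)
    have "X_fun N p (A, B) = C p / (\<delta> p)\<^sup>2"
      unfolding X_fun_eq[OF nd pN(1)] X_alt_def fst_conv snd_conv cB[OF pN(1)] cB[OF pN(2)]
        cS[OF pN(1)] cS[OF pN(2)] detA detB \<delta>Np C_def
      using \<delta>[of p] \<delta>[of N] \<kappa>[of p] \<kappa>[of N] \<kappa>[of "N - p"] a
      by (simp add: field_simps power2_eq_square)
    then show ?thesis
      unfolding \<delta>2 using C \<xi> by simp
  qed
  ultimately show ?thesis
    using Y by blast
qed

lemma cpoly_eval_cong:
  assumes "\<And>v. v \<in> cpoly_vars P \<Longrightarrow> x v = y v"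
  shows "cpoly_eval P x = cpoly_eval P y"
proof -
  have "x v = y v" if "m \<in> Poly_Mapping.keys P" "v \<in> Poly_Mapping.keys m" for m v
    using that assms[of v] by (auto simp: cpoly_vars_def)
  then show ?thesis
    by (simp add: cpoly_eval_def)
qed

lemma alg_independent_casimirs:
  assumes "N \<ge> 1"
  shows "alg_independent_on (generic N) ({1..N div 2} <+> {1..N div 2})
       (case_sum (\<lambda>p (A, B). Y_fun N p A) (X_fun N))"
  unfolding alg_independent_on_def
proof (intro allI impI)
  fix P :: "(nat + nat) cpoly"
  assume P: "cpoly_vars P \<subseteq> {1..N div 2} <+> {1..N div 2} \<and> P \<noteq> 0"
  then obtain x where x: "\<And>v. x v \<noteq> 0" "cpoly_eval P x \<noteq> 0"
    using cpoly_nonvanishing_point by blast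
  obtain A B where AB: "(A, B) \<in> generic N"
    "\<forall>p\<in>{1..N div 2}. Y_fun N p A = x (Inl p) \<and> X_fun N p (A, B) = x (Inr p)"
    using antidiag_realization[OF assms, of "\<lambda>p. x (Inr p)" "\<lambda>p. x (Inl p)"] x(1) by blast
  have "cpoly_eval P (\<lambda>v. case_sum (\<lambda>p (A, B). Y_fun N p A) (X_fun N) v (A, B)) = cpoly_eval P x"
    using P AB(2) by (intro cpoly_eval_cong) (auto split: sum.split)
  then show "\<exists>z\<in>generic N. cpoly_eval P (\<lambda>v. case_sum (\<lambda>p (A, B). Y_fun N p A) (X_fun N) v z) \<noteq> 0"
    using AB(1) x(2) by (intro bexI[of _ "(A, B)"]) simp_all
qed

theorem theorem6p3:
  fixes N :: nat
  assumes "N \<ge> 1"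
  shows "\<exists>Y :: nat \<Rightarrow> complex mat \<Rightarrow> complex.
     (\<forall>A\<in>carrier_mat N N. det A \<noteq> 0 \<longrightarrow>
        (\<forall>z::complex. z \<noteq> 0 \<longrightarrow>
           det (z \<cdot>\<^sub>m A + inverse z \<cdot>\<^sub>m transpose_mat A) / det A =
             (z powi int N + z powi (- int N)) +
             (\<Sum>p = 1..N div 2.
                (z powi (int N - 2 * int p) + z powi (2 * int p - int N)) * Y p A))) \<and>
     (\<forall>p\<in>{1..N div 2}. casimir_on N (nondegenerate N) (\<lambda>(A, B). Y p A)) \<and>
     (\<forall>p\<in>{1..N div 2}. casimir_on N (X_domain N p) (X_fun N p)) \<and>
     alg_independent_on (generic N) ({1..N div 2} <+> {1..N div 2})
       (case_sum (\<lambda>p (A, B). Y p A) (X_fun N))"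
  using assms
  by (intro exI[of _ "Y_fun N"] conjI ballI allI impI Y_fun_expansion casimir_Y_fun casimir_X_fun
      alg_independent_casimirs) auto

end
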